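(* Let $I\subset\mathbb{R}$ be a bounded open interval and let $\mu$ be a finite positive Borel measure on $I$. Let $\mu=\mu_a+\mu_s$ be the decomposition of $\mu$ into its absolutely continuous part $\mu_a$ and its singular part $\mu_s$ with respect to the Lebesgue measure $\mathcal{L}^1$, let $A\subseteq I$ be a Lebesgue-negligible Borel set on which $\mu_s$ is concentrated, let $f$ be the density of $\mu_a$, and let $$M=\left\{x\in I:\ \forall \varepsilon>0,\ \int_{I\cap B(x,\varepsilon)}\frac{dt}{f(t)}=+\infty\right\}.$$ Then for $\mu$-a.e. $x\in I$ the tangent space to $\mu$ at $x$ is given by $$T_\mu(x)=\begin{cases}\{0\} & \text{if } x\in M\cup A,\\ \mathbb{R} & \text{otherwise.}\end{cases}$$
   Context: Convention: $1/f(t)=+\infty$ where $f(t)=0$; $B(x,\varepsilon)$ is the open ball (interval) of center $x$ and radius $\varepsilon$. Sobolev space and gradients with respect to $\mu$ (Zhikov's definition). A function $u\in L^2_\mu(I)$ belongs to $H^1_\mu(I)$ if there exist a sequence $(u_n)_n$ in $C^\infty(\overline{I})$ and $v\in L^2_\mu(I)$ such that $u_n\to u$ and $u_n'\to v$ in $L^2_\mu(I)$. The set of all such limits $v$ (over all such sequences) is denoted $\Gamma(u)$; its elements are called gradients of $u$. $\Gamma(u)$ is a closed affine subspace of $L^2_\mu(I)$ with direction the closed linear subspace $\Gamma(0)$. Tangent space. Let $\xi=p_{\Gamma(0)}(1)$ be the orthogonal projection, in the Hilbert space $L^2_\mu(I)$, of the constant function $1$ onto $\Gamma(0)$. For $\mu$-a.e.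 $x\in I$, $T_\mu(x)=(\operatorname{span}(\xi(x)))^\perp\subseteq\mathbb{R}$; so $T_\mu(x)$ is either $\{0\}$ or $\mathbb{R}$. *)

theory Defs
  imports "HOL-Analysis.Analysis"
begin

(* L^2 is rendered at the level of representatives: its elements are functions, and functions
   that agree almost everywhere are not identified. All notions below are invariant under
   modification on null sets. *)
definition L2 :: "real measure \<Rightarrow> (real \<Rightarrow> real) set" where
  "L2 \<mu> = {u \<in> borel_measurable \<mu>. integrable \<mu> (\<lambda>x. (u x)\<^sup>2)}"

definition L2_inner :: "real measure \<Rightarrow> (real \<Rightarrow> real) \<Rightarrow> (real \<Rightarrow> real) \<Rightarrow> real" where
  "L2_inner \<mu> u v = (LINT x|\<mu>. u x * v x)"

definition L2_norm :: "real measure \<Rightarrow> (real \<Rightarrow> real) \<Rightarrow> real" where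
  "L2_norm \<mu> u = sqrt (L2_inner \<mu> u u)"

definition L2_tendsto :: "real measure \<Rightarrow> (nat \<Rightarrow> real \<Rightarrow> real) \<Rightarrow> (real \<Rightarrow> real) \<Rightarrow> bool" where
  "L2_tendsto \<mu> u w \<longleftrightarrow>
     (\<forall>n. u n \<in> L2 \<mu>) \<and> w \<in> L2 \<mu> \<and> (\<lambda>n. L2_norm \<mu> (\<lambda>x. u n x - w x)) \<longlonglongrightarrow> 0"

(* The class of smooth functions on the closure of I: D n is the n-th derivative, one-sided at
   the boundary points. The values of u outside the closure of I are irrelevant. *)
definition smooth_closure :: "real set \<Rightarrow> (real \<Rightarrow> real) \<Rightarrow> bool" where
  "smooth_closure I u \<longleftrightarrow>
     (\<exists>D :: nat \<Rightarrow> real \<Rightarrow> real.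
        (\<forall>x\<in>closure I. D 0 x = u x) \<and>
        (\<forall>n. \<forall>x\<in>closure I. (D n has_real_derivative D (Suc n) x) (at x within closure I)))"

(* Gamma(u). The function u belongs to the Sobolev space H^1 with respect to \<mu> iff this set is
   nonempty. The measure \<mu> lives on the open set I, so deriv is only used at interior points. *)
definition gradients :: "real set \<Rightarrow> real measure \<Rightarrow> (real \<Rightarrow> real) \<Rightarrow> (real \<Rightarrow> real) set" where
  "gradients I \<mu> u =
     {v. \<exists>un :: nat \<Rightarrow> real \<Rightarrow> real.
           (\<forall>n. smooth_closure I (un n)) \<and>
           L2_tendsto \<mu> un u \<and> L2_tendsto \<mu> (\<lambda>n. deriv (un n)) v}"

definition is_L2_projection ::
    "real measure \<Rightarrow> (real \<Rightarrow> real) set \<Rightarrow> (real \<Rightarrow> real) \<Rightarrow> (real \<Rightarrow> real) \<Rightarrow> bool" where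
  "is_L2_projection \<mu> S g p \<longleftrightarrow>
     p \<in> S \<and> (\<forall>w\<in>S. L2_inner \<mu> (\<lambda>x. g x - p x) w = 0)"

lemma L2_mult_integrable:
  assumes "u \<in> L2 \<mu>" "v \<in> L2 \<mu>"
  shows "integrable \<mu> (\<lambda>x. u x * v x)"
proof (rule Bochner_Integration.integrable_bound)
  show "integrable \<mu> (\<lambda>x. (u x)\<^sup>2 + (v x)\<^sup>2)"
    using assms by (auto simp: L2_def)
  show "(\<lambda>x. u x * v x) \<in> borel_measurable \<mu>"
    using assms by (auto simp: L2_def)
  have "\<bar>a * b\<bar> \<le> a\<^sup>2 + b\<^sup>2" for a b :: real
  proof -
    have "2 * (\<bar>a\<bar> * \<bar>b\<bar>) \<le> a\<^sup>2 + b\<^sup>2"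
      using sum_squares_bound[of "\<bar>a\<bar>" "\<bar>b\<bar>"] by simp
    moreover have "0 \<le> \<bar>a\<bar> * \<bar>b\<bar>" by simp
    ultimately show ?thesis unfolding abs_mult by linarith
  qed
  then show "AE x in \<mu>. norm (u x * v x) \<le> norm ((u x)\<^sup>2 + (v x)\<^sup>2)"
    by (simp add: abs_of_nonneg)
qed

(* Two representatives of an orthogonal projection agree almost everywhere, so the choice
   made in the definition of xi below is immaterial. *)
lemma is_L2_projection_AE_unique:
  assumes S: "S \<subseteq> L2 \<mu>" and g: "g \<in> L2 \<mu>"
    and p: "is_L2_projection \<mu> S g p" and q: "is_L2_projection \<mu> S g q"
  shows "AE x in \<mu>. p x = q x"
proof -
  have pS: "p \<in> S" and qS: "q \<in> S"
    using p q by (auto simp: is_L2_projection_def)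
  have pL: "p \<in> L2 \<mu>" and qL: "q \<in> L2 \<mu>"
    using pS qS S by auto
  note int [simp] = L2_mult_integrable[OF g pL] L2_mult_integrable[OF g qL]
    L2_mult_integrable[OF pL pL] L2_mult_integrable[OF pL qL]
    L2_mult_integrable[OF qL pL] L2_mult_integrable[OF qL qL]
  have "L2_inner \<mu> (\<lambda>x. g x - p x) p = 0" "L2_inner \<mu> (\<lambda>x. g x - p x) q = 0"
    "L2_inner \<mu> (\<lambda>x. g x - q x) p = 0" "L2_inner \<mu> (\<lambda>x. g x - q x) q = 0"
    using p q pS qS by (auto simp: is_L2_projection_def)
  then have *: "(LINT x|\<mu>. g x * p x) = (LINT x|\<mu>. p x * p x)"
    "(LINT x|\<mu>. g x * q x) = (LINT x|\<mu>. p x * q x)"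
    "(LINT x|\<mu>. g x * p x) = (LINT x|\<mu>. q x * p x)"
    "(LINT x|\<mu>. g x * q x) = (LINT x|\<mu>. q x * q x)"
    by (simp_all add: L2_inner_def left_diff_distrib)
  have eq: "(\<lambda>x. (p x - q x)\<^sup>2) = (\<lambda>x. (p x * p x - p x * q x) - (q x * p x - q x * q x))"
    by (auto simp: power2_eq_square algebra_simps)
  have "(LINT x|\<mu>. (p x - q x)\<^sup>2) = 0"
    unfolding eq using * by (simp add: mult.commute[of "q _" "p _"])
  moreover have "integrable \<mu> (\<lambda>x. (p x - q x)\<^sup>2)"
    unfolding eq by simp
  ultimately have "AE x in \<mu>. (p x - q x)\<^sup>2 = 0"
    by (subst (asm) integral_nonneg_eq_0_iff_AE) auto
  then show ?thesis by simp
qed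

lemma gradients_subset_L2: "gradients I \<mu> u \<subseteq> L2 \<mu>"
  by (auto simp: gradients_def L2_tendsto_def)

definition xi :: "real set \<Rightarrow> real measure \<Rightarrow> real \<Rightarrow> real" where
  "xi I \<mu> = (SOME p. is_L2_projection \<mu> (gradients I \<mu> (\<lambda>_. 0)) (\<lambda>_. 1) p)"

definition tangent_space :: "real set \<Rightarrow> real measure \<Rightarrow> real \<Rightarrow> real set" where
  "tangent_space I \<mu> x = orthogonal_comp (span {xi I \<mu> x})"

(* Division is taken in ennreal, where 1 / 0 = \<infinity>. *)
definition degenerate_set :: "real set \<Rightarrow> (real \<Rightarrow> ennreal) \<Rightarrow> real set" where
  "degenerate_set I f =
     {x \<in> I. \<forall>\<epsilon>>0. (\<integral>\<^sup>+t\<in>I \<inter> ball x \<epsilon>. 1 / f t \<partial>lborel) = \<infinity>}"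

lemma one_divide_zero_ennreal: "1 / (0 :: ennreal) = \<infinity>"
  by (simp add: ennreal_divide_zero)

end

theory Submission
  imports Defs
begin

text \<open>
  Write \<open>M\<close> for the degenerate set of \<open>f\<close>. The tangent space at \<open>x\<close> is \<open>{0}\<close> or the whole line according
  to whether \<open>\<xi>(x) \<noteq> 0\<close> or \<open>\<xi>(x) = 0\<close>, so the theorem says that the projection \<open>\<xi>\<close> of \<open>1\<close> onto \<open>\<Gamma>(0)\<close> is
  nonzero on \<open>M \<union> A\<close> and zero elsewhere. In fact \<open>\<xi>\<close> is the indicator of \<open>M \<union> A\<close>. A projection is
  determined almost everywhere by its characterisation, so two facts suffice: every element of
  \<open>\<Gamma>(0)\<close> vanishes almost everywhere off \<open>M \<union> A\<close>, which makes \<open>1 - 1\<^bsub>M \<union> A\<^esub>\<close> orthogonal to \<open>\<Gamma>(0)\<close>; and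
  \<open>1\<^bsub>M \<union> A\<^esub>\<close> belongs to \<open>\<Gamma>(0)\<close>. The existence of projections is thereby proved and not presupposed.

  \<^emph>\<open>Elements of \<open>\<Gamma>(0)\<close> vanish off \<open>M \<union> A\<close>\<close> (\<open>gradient_zero_AE\<close>). If \<open>1/f\<close> is integrable on \<open>[c,
      d]\<close>, the
  Cauchy-Schwarz inequality bounds the Lebesgue \<open>L\<^sup>1\<close> norm on \<open>[c, d]\<close> by the \<open>L\<^sup>2\<close> norm with respect to \<open>\<mu>\<close>.
  Hence \<open>u\<^sub>n \<rightarrow> 0\<close> and \<open>u\<^sub>n' \<rightarrow> v\<close> also hold in \<open>L\<^sup>1(c, d)\<close>, where integration by parts shows that \<open>v\<close> is the
  distributional derivative of \<open>0\<close>. Countably many such intervals cover the complement of \<open>M\<close>.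

  \<^emph>\<open>The indicator of \<open>M \<union> A\<close> lies in \<open>\<Gamma>(0)\<close>\<close> (\<open>indicator_in_gradients_zero\<close>). One looks for \<open>g\<close>
      close to
  \<open>1\<^bsub>M \<union> A\<^esub>\<close> in \<open>L\<^sup>2(\<mu>)\<close> whose primitive is uniformly small. The part on \<open>A\<close> is free because \<open>A\<close> is Lebesgue
  null. Near a point of \<open>M\<close> the integral of \<open>1/f\<close> is infinite, so a function \<open>r \<ge> 0\<close> supported in an
  arbitrarily small interval can have integral \<open>1\<close> and arbitrarily small energy \<open>\<integral> r\<^sup>2 d\<mu>\<close>
  (\<open>low_energy_unit_mass\<close>). Cut the interval into short cells and subtract in each cell a multiple of
  such an \<open>r\<close> that cancels the Lebesgue measure of \<open>M\<close> there (\<open>balanced_correction\<close>): the primitive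
  returns to \<open>0\<close> at the end of every cell, hence never exceeds the cell length. Finally replace \<open>g\<close> by a
  polynomial that is close to it in \<open>L\<^sup>2\<close> both of \<open>\<mu>\<close> and of Lebesgue measure; its primitive is again a
  polynomial, hence smooth up to the boundary.

  Both halves rest on the density of polynomials in \<open>L\<^sup>2\<close> of a finite Borel measure on a compact
  interval: for the first one it gives enough polynomial test functions.
\<close>

section \<open>Polynomials are dense in \<open>L\<^sup>2\<close> of a finite measure on a compact interval\<close>

text \<open>
  Regularity of the measure sandwiches \<open>E\<close> between a compact \<open>K\<close> and an open \<open>U\<close> of nearly equal measure; a
  Urysohn function that is \<open>1\<close> on \<open>K\<close> and \<open>0\<close> off \<open>U\<close> can differ from the indicator only on \<open>U - K\<close>, and by
  at most \<open>1\<close>.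
\<close>

lemma finite_borel_indicator_approx_continuous:
  fixes M :: "real measure"
  assumes M: "finite_measure M" "sets M = sets borel" and E: "E \<in> sets borel" and e: "e > 0"
  shows "\<exists>\<phi>::real \<Rightarrow> real. continuous_on UNIV \<phi> \<and>
           (\<integral>\<^sup>+x. ennreal ((indicator E x - \<phi> x)\<^sup>2) \<partial>M) < ennreal e"
proof -
  interpret finite_measure M by fact
  have inf: "emeasure M (space M) \<noteq> \<infinity>" by simp
  have sE: "E \<in> sets M" using E M by simp
  have "emeasure M E < (SUP K \<in> {K. K \<subseteq> E \<and> compact K}. emeasure M K) + ennreal (e/2)"
    unfolding inner_regular[OF M(2) inf E, symmetric] using e
    by (simp add: emeasure_eq_measure ennreal_plus[symmetric] ennreal_less_iff del: ennreal_plus)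
  then have "\<exists>K\<in>{K. K \<subseteq> E \<and> compact K}. emeasure M E < emeasure M K + ennreal (e/2)"
  proof (rule contrapos_pp)
    assume *: "\<not> (\<exists>K\<in>{K. K \<subseteq> E \<and> compact K}. emeasure M E < emeasure M K + ennreal (e/2))"
    have "(SUP K \<in> {K. K \<subseteq> E \<and> compact K}. emeasure M K) + ennreal (e/2)
        = (SUP K \<in> {K. K \<subseteq> E \<and> compact K}. emeasure M K + ennreal (e/2))"
      by (subst ennreal_SUP_add_left) auto
    also have "\<dots> \<le> emeasure M E"
      using * by (intro SUP_least) (auto simp: not_less)
    finally show "\<not> emeasure M E < (SUP K \<in> {K. K \<subseteq> E \<and> compact K}. emeasure M K) + ennreal (e/2)"
      by (simp add: not_less)
  qed
  then obtain K where K: "K \<subseteq> E" "compact K" "emeasure M E < emeasure M K + ennreal (e/2)"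
    by auto
  have "(INF U \<in> {U. E \<subseteq> U \<and> open U}. emeasure M U) < emeasure M E + ennreal (e/2)"
    unfolding outer_regular[OF M(2) inf E, symmetric] using e
    by (simp add: emeasure_eq_measure ennreal_plus[symmetric] ennreal_less_iff del: ennreal_plus)
  then obtain U where U: "E \<subseteq> U" "open U" "emeasure M U < emeasure M E + ennreal (e/2)"
    by (auto simp: INF_less_iff)
  have sK: "K \<in> sets M" and sU: "U \<in> sets M"
    using K U M(2) by (auto simp: borel_compact)
  have "closed K" "closed (- U)" "K \<inter> - U = {}"
    using K U by (auto intro: compact_imp_closed)
  from Urysohn[OF this, of 1 0]
  obtain \<phi> :: "real \<Rightarrow> real" where \<phi>: "continuous_on UNIV \<phi>" "\<And>x. \<phi> x \<in> closed_segment 1 0"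
      "\<And>x. x \<in> K \<Longrightarrow> \<phi> x = 1" "\<And>x. x \<in> - U \<Longrightarrow> \<phi> x = 0"
    by blast
  have r: "0 \<le> \<phi> x" "\<phi> x \<le> 1" for x
    using \<phi>(2)[of x] by (auto simp: closed_segment_eq_real_ivl)
  have "(indicator E x - \<phi> x)\<^sup>2 \<le> indicator (U - K) x" for x
  proof -
    have "\<bar>indicator E x - \<phi> x\<bar> \<le> 1"
      using r[of x] by (auto split: split_indicator)
    then have "(indicator E x - \<phi> x)\<^sup>2 \<le> 1" by (simp add: abs_square_le_1)
    moreover have "x \<in> K \<Longrightarrow> indicator E x - \<phi> x = 0" "x \<notin> U \<Longrightarrow> indicator E x - \<phi> x = 0"
      using \<phi>(3,4)[of x] K U by (auto split: split_indicator)
    ultimately show ?thesis by (auto split: split_indicator)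
  qed
  then have "(\<integral>\<^sup>+x. ennreal ((indicator E x - \<phi> x)\<^sup>2) \<partial>M) \<le> (\<integral>\<^sup>+x. indicator (U - K) x \<partial>M)"
    by (intro nn_integral_mono) (simp add: ennreal_indicator[symmetric] del: ennreal_indicator)
  also have "\<dots> = emeasure M (U - K)" using sK sU by simp
  also have "\<dots> < ennreal e"
  proof -
    have "measure M U < measure M E + e/2" "measure M E < measure M K + e/2"
      using K(3) U(3) e
      by (auto simp: emeasure_eq_measure ennreal_plus[symmetric] ennreal_less_iff simp del: ennreal_plus)
    moreover have "measure M (U - K) = measure M U - measure M K"
      using sK sU K U by (intro finite_measure_Diff) auto
    ultimately show ?thesis using e
      by (simp only: emeasure_eq_measure) (intro ennreal_lessI, auto)
  qed
  finally show ?thesis using \<phi>(1) by blast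
qed

lemma finite_borel_continuous_approx_poly:
  fixes M :: "real measure" and \<phi> :: "real \<Rightarrow> real"
  assumes M: "finite_measure M" "sets M = sets borel" and conc: "emeasure M (- {a..b}) = 0"
    and \<phi>: "continuous_on {a..b} \<phi>" and e: "e > 0"
  shows "\<exists>p. real_polynomial_function p \<and> (\<integral>\<^sup>+x. ennreal ((\<phi> x - p x)\<^sup>2) \<partial>M) < ennreal e"
proof -
  interpret finite_measure M by fact
  define s where "s = sqrt (e / (measure M (space M) + 1))"
  have s: "s > 0" using e measure_nonneg[of M "space M"] unfolding s_def
    by (intro real_sqrt_gt_zero divide_pos_pos) linarith+
  have s2: "s\<^sup>2 = e / (measure M (space M) + 1)"
    using e measure_nonneg[of M "space M"] unfolding s_def
    by (intro real_sqrt_pow2 divide_nonneg_nonneg) linarith+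
  from Stone_Weierstrass_real_polynomial_function[OF compact_Icc \<phi> s]
  obtain p where p: "real_polynomial_function p" "\<And>x. x \<in> {a..b} \<Longrightarrow> \<bar>\<phi> x - p x\<bar> < s"
    by blast
  have "AE x in M. x \<in> {a..b}"
    using conc M(2) sets_eq_imp_space_eq[OF M(2)] by (subst AE_iff_measurable[of "- {a..b}"]) auto
  then have "AE x in M. ennreal ((\<phi> x - p x)\<^sup>2) \<le> ennreal (s\<^sup>2)"
  proof eventually_elim
    case (elim x)
    then have "\<bar>\<phi> x - p x\<bar> \<le> s" using p(2) by (simp add: less_imp_le)
    then have "(\<phi> x - p x)\<^sup>2 \<le> s\<^sup>2" by (rule abs_le_square_iff[THEN iffD1, of _ s, simplified, OF
        order_trans]) (use s in auto)
    then show ?case by (rule ennreal_leI)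
  qed
  then have "(\<integral>\<^sup>+x. ennreal ((\<phi> x - p x)\<^sup>2) \<partial>M) \<le> (\<integral>\<^sup>+x. ennreal (s\<^sup>2) \<partial>M)"
    by (rule nn_integral_mono_AE)
  also have "\<dots> = ennreal (s\<^sup>2 * measure M (space M))"
    by (simp add: emeasure_eq_measure ennreal_mult)
  also have "\<dots> < ennreal e"
  proof -
    have "e * measure M (space M) < e * (measure M (space M) + 1)"
      using e by simp
    moreover have "measure M (space M) + 1 > 0"
      using measure_nonneg[of M "space M"] by linarith
    ultimately show ?thesis
      using e unfolding s2 by (intro ennreal_lessI) (simp_all add: pos_divide_less_eq)
  qed
  finally show ?thesis using p(1) by blast
qed

lemma real_square_triangle: "(x - z)\<^sup>2 \<le> 2 * (x - y)\<^sup>2 + 2 * (y - z)\<^sup>2" for x y z :: real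
  using sum_squares_bound[of "x - y" "y - z"] by (simp add: power2_eq_square algebra_simps)

lemma nn_integral_square_triangle:
  fixes u v w :: "'a \<Rightarrow> real"
  assumes [measurable]: "u \<in> borel_measurable M" "v \<in> borel_measurable M" "w \<in> borel_measurable M"
  shows "(\<integral>\<^sup>+x. ennreal ((u x - w x)\<^sup>2) \<partial>M)
     \<le> 2 * (\<integral>\<^sup>+x. ennreal ((u x - v x)\<^sup>2) \<partial>M) + 2 * (\<integral>\<^sup>+x. ennreal ((v x - w x)\<^sup>2) \<partial>M)"
proof -
  have "(\<integral>\<^sup>+x. ennreal ((u x - w x)\<^sup>2) \<partial>M)
     \<le> (\<integral>\<^sup>+x. 2 * ennreal ((u x - v x)\<^sup>2) + 2 * ennreal ((v x - w x)\<^sup>2) \<partial>M)"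
  proof (intro nn_integral_mono)
    fix x
    have "ennreal ((u x - w x)\<^sup>2) \<le> ennreal (2 * (u x - v x)\<^sup>2 + 2 * (v x - w x)\<^sup>2)"
      by (intro ennreal_leI real_square_triangle)
    then show "ennreal ((u x - w x)\<^sup>2) \<le> 2 * ennreal ((u x - v x)\<^sup>2) + 2 * ennreal ((v x - w x)\<^sup>2)"
      by (simp add: ennreal_plus ennreal_mult)
  qed
  also have "\<dots> = 2 * (\<integral>\<^sup>+x. ennreal ((u x - v x)\<^sup>2) \<partial>M) + 2 * (\<integral>\<^sup>+x. ennreal ((v x - w x)\<^sup>2) \<partial>M)"
    by (simp add: nn_integral_add nn_integral_cmult)
  finally show ?thesis .
qed

lemma real_polynomial_function_measurable [measurable]:
  fixes p :: "real \<Rightarrow> real"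
  assumes "real_polynomial_function p"
  shows "p \<in> borel_measurable borel"
  by (intro borel_measurable_continuous_onI continuous_on_polymonial_function)
     (use assms in \<open>simp add: real_polynomial_function_eq\<close>)

lemma ennreal_two_quarters_less:
  fixes A B :: ennreal
  assumes "e > 0" "A < ennreal (e/4)" "B < ennreal (e/4)"
  shows "2 * A + 2 * B < ennreal e"
proof -
  obtain x y where xy: "A = ennreal x" "B = ennreal y" "0 \<le> x" "0 \<le> y"
    using assms(2,3) by (cases A; cases B) auto
  then have "x < e/4" "y < e/4" using assms by (auto simp: ennreal_less_iff)
  moreover have "2 * A + 2 * B = ennreal (2 * x + 2 * y)"
    using xy by (simp add: ennreal_mult ennreal_plus)
  ultimately show ?thesis using xy assms(1) by (simp only:) (intro ennreal_lessI, auto)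
qed

text \<open>
  Induction over the measurable functions. The bound is a premise of the statement that is proved by
  induction: it passes from a nonnegative function to its smaller building blocks, and in the limit
  step it supplies the constant that dominates the convergence.
\<close>

lemma finite_borel_poly_dense_nonneg:
  fixes M :: "real measure" and g :: "real \<Rightarrow> real"
  assumes M: "finite_measure M" "sets M = sets borel" and conc: "emeasure M (- {a..b}) = 0"
    and g: "g \<in> borel_measurable borel" "\<And>x. 0 \<le> g x"
  shows "(\<exists>B. \<forall>x. g x \<le> B) \<longrightarrow> (\<forall>e>0. \<exists>p. real_polynomial_function p
      \<and> (\<integral>\<^sup>+x. ennreal ((g x - p x)\<^sup>2) \<partial>M) < ennreal e)"
  using g
proof (induction g rule: borel_measurable_induct_real)
  case (set E)
  show ?case
  proof (intro impI allI)
    fix e :: real assume e: "e > 0"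
    obtain \<phi> :: "real \<Rightarrow> real" where \<phi>: "continuous_on UNIV \<phi>"
           "(\<integral>\<^sup>+x. ennreal ((indicator E x - \<phi> x)\<^sup>2) \<partial>M) < ennreal (e/4)"
      using finite_borel_indicator_approx_continuous[OF M set, of "e/4"] e by auto
    obtain p where p: "real_polynomial_function p" "(\<integral>\<^sup>+x. ennreal ((\<phi> x - p x)\<^sup>2) \<partial>M) < ennreal (e/4)"
      using finite_borel_continuous_approx_poly[OF M conc continuous_on_subset[OF \<phi>(1)], of "e/4"] e by auto
    have [measurable]: "p \<in> borel_measurable M" "\<phi> \<in> borel_measurable M" "E \<in> sets M"
      using real_polynomial_function_measurable[OF p(1)] borel_measurable_continuous_onI[OF \<phi>(1)] set
      by (simp_all add: measurable_cong_sets[OF M(2) refl] M(2))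
    have "(\<integral>\<^sup>+x. ennreal ((indicator E x - p x)\<^sup>2) \<partial>M)
        \<le> 2 * (\<integral>\<^sup>+x. ennreal ((indicator E x - \<phi> x)\<^sup>2) \<partial>M) + 2 * (\<integral>\<^sup>+x. ennreal ((\<phi> x - p x)\<^sup>2) \<partial>M)"
      by (intro nn_integral_square_triangle) auto
    also have "\<dots> < ennreal e"
      using ennreal_two_quarters_less[OF e \<phi>(2) p(2)] .
    finally show "\<exists>p. real_polynomial_function p \<and> (\<integral>\<^sup>+x. ennreal ((indicator E x - p x)\<^sup>2) \<partial>M) < ennreal e"
      using p(1) by blast
  qed
next
  case (mult u c)
  show ?case
  proof (cases "c = 0")
    case True
    then show ?thesis by (auto intro!: exI[of _ "\<lambda>_. 0"] real_polynomial_function.intros)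
  next
    case False
    then have c: "c > 0" using mult by simp
    show ?thesis
    proof (intro impI allI)
      fix e :: real assume e: "e > 0" and "\<exists>B. \<forall>x. c * u x \<le> B"
      then obtain B where "\<And>x. c * u x \<le> B" by auto
      then have "\<forall>x. u x \<le> B / c" using c by (simp add: field_simps)
      then obtain p where p: "real_polynomial_function p"
          "(\<integral>\<^sup>+x. ennreal ((u x - p x)\<^sup>2) \<partial>M) < ennreal (e / c\<^sup>2)"
        using mult.IH[THEN mp, OF exI, THEN spec[of _ "e / c\<^sup>2"], THEN mp] e c by auto
      have [measurable]: "p \<in> borel_measurable M" "u \<in> borel_measurable M"
        using real_polynomial_function_measurable[OF p(1)] mult
        by (simp_all add: measurable_cong_sets[OF M(2) refl] M(2))
      have "(\<integral>\<^sup>+x. ennreal ((c * u x - c * p x)\<^sup>2) \<partial>M) = (\<integral>\<^sup>+x. ennreal (c\<^sup>2) * ennreal ((u x - p x)\<^sup>2) \<partial>M)"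
        by (simp add: ennreal_mult[symmetric] power_mult_distrib[symmetric] right_diff_distrib)
      also have "\<dots> = ennreal (c\<^sup>2) * (\<integral>\<^sup>+x. ennreal ((u x - p x)\<^sup>2) \<partial>M)"
        by (rule nn_integral_cmult) simp
      also have "\<dots> < ennreal (c\<^sup>2) * ennreal (e / c\<^sup>2)"
        using p(2) c by (intro ennreal_mult_strict_left_mono) auto
      also have "\<dots> = ennreal e" using c e by (simp add: ennreal_mult[symmetric])
      finally show "\<exists>p. real_polynomial_function p \<and> (\<integral>\<^sup>+x. ennreal ((c * u x - p x)\<^sup>2) \<partial>M) < ennreal e"
        using p(1) by (intro exI[of _ "\<lambda>x. c * p x"]) auto
    qed
  qed
next
  case (add u v)
  show ?case
  proof (intro impI allI)
    fix e :: real assume e: "e > 0" and "\<exists>B. \<forall>x. v x + u x \<le> B"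
    then obtain B where B: "\<And>x. v x + u x \<le> B" by auto
    have "\<forall>x. u x \<le> B" "\<forall>x. v x \<le> B" 
    proof safe
      fix x show "u x \<le> B" "v x \<le> B" using B[of x] add.hyps(2,4)[of x] by linarith+
    qed
    then obtain p q where p: "real_polynomial_function p"
        "(\<integral>\<^sup>+x. ennreal ((u x - p x)\<^sup>2) \<partial>M) < ennreal (e / 4)"
       and q: "real_polynomial_function q" "(\<integral>\<^sup>+x. ennreal ((v x - q x)\<^sup>2) \<partial>M) < ennreal (e / 4)"
      using add.IH[THEN mp, OF exI, THEN spec[of _ "e/4"], THEN mp] e
          by (meson divide_pos_pos zero_less_numeral)
    have [measurable]: "p \<in> borel_measurable M" "u \<in> borel_measurable M" "q \<in> borel_measurable M"
        "v \<in> borel_measurable M"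
      using real_polynomial_function_measurable[OF p(1)] real_polynomial_function_measurable[OF q(1)] add
      by (simp_all add: measurable_cong_sets[OF M(2) refl] M(2))
    have "(\<integral>\<^sup>+x. ennreal (((v x + u x) - (p x + q x))\<^sup>2) \<partial>M)
       \<le> 2 * (\<integral>\<^sup>+x. ennreal (((v x + u x) - (p x + v x))\<^sup>2) \<partial>M) + 2 * (\<integral>\<^sup>+x. ennreal (((p x + v x) - (p x + q
           x))\<^sup>2) \<partial>M)"
      by (intro nn_integral_square_triangle) auto
    also have "\<dots> < ennreal e"
      using ennreal_two_quarters_less[OF e p(2) q(2)] by (simp add: algebra_simps)
    finally show "\<exists>p. real_polynomial_function p \<and> (\<integral>\<^sup>+x. ennreal ((v x + u x - p x)\<^sup>2) \<partial>M) < ennreal e"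
      using p(1) q(1) by (intro exI[of _ "\<lambda>x. p x + q x"]) auto
  qed
next
  case (seq U)
  interpret finite_measure M by fact
  show ?case
  proof (intro impI allI)
    fix e :: real assume e: "e > 0" and "\<exists>B. \<forall>x. g x \<le> B"
    then obtain B where B: "\<And>x. g x \<le> B" by auto
    have le: "U i x \<le> g x" for i x
      using seq by (intro incseq_le) (auto simp: incseq_def le_fun_def)
    have B': "\<forall>x. U i x \<le> B" for i using le B by (meson order_trans)
    have gm: "g \<in> borel_measurable borel"
      by (rule borel_measurable_LIMSEQ_real[of _ U]) (use seq in auto)
    have [measurable]: "U i \<in> borel_measurable M" "g \<in> borel_measurable M" for i
      using seq gm by (simp_all add: measurable_cong_sets[OF M(2) refl] M(2))
    have "(\<lambda>i. \<integral>\<^sup>+x. ennreal ((g x - U i x)\<^sup>2) \<partial>M) \<longlonglongrightarrow> (\<integral>\<^sup>+x. 0 \<partial>M)"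
    proof (rule nn_integral_dominated_convergence[where w = "\<lambda>_. ennreal (B\<^sup>2)"])
      show "AE x in M. ennreal ((g x - U i x)\<^sup>2) \<le> ennreal (B\<^sup>2)" for i
        using le seq.hyps(2) B by (intro AE_I2 ennreal_leI power_mono) (auto
            simp: algebra_simps add_increasing2)
      show "(\<integral>\<^sup>+ x. ennreal (B\<^sup>2) \<partial>M) < \<infinity>"
        by (simp add: emeasure_eq_measure ennreal_mult_less_top)
      show "AE x in M. (\<lambda>i. ennreal ((g x - U i x)\<^sup>2)) \<longlonglongrightarrow> 0"
      proof (intro AE_I2)
        fix x
        have "(\<lambda>i. (g x - U i x)\<^sup>2) \<longlonglongrightarrow> (g x - g x)\<^sup>2"
          using seq.hyps(4)[of x] by (intro tendsto_intros) auto
        then show "(\<lambda>i. ennreal ((g x - U i x)\<^sup>2)) \<longlonglongrightarrow> 0"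
          using tendsto_ennrealI by fastforce
      qed
    qed auto
    then have "eventually (\<lambda>i. (\<integral>\<^sup>+x. ennreal ((g x - U i x)\<^sup>2) \<partial>M) < ennreal (e/4)) sequentially"
      by (intro order_tendstoD(2)[where y=0]) (use e in auto)
    then obtain i where i: "(\<integral>\<^sup>+x. ennreal ((g x - U i x)\<^sup>2) \<partial>M) < ennreal (e/4)"
      by (auto simp: eventually_sequentially)
    obtain p where p: "real_polynomial_function p" "(\<integral>\<^sup>+x. ennreal ((U i x - p x)\<^sup>2) \<partial>M) < ennreal (e / 4)"
      using seq.IH[of i, THEN mp, OF exI, OF B', THEN spec[of _ "e/4"], THEN mp] e by auto
    have [measurable]: "p \<in> borel_measurable M"
      using real_polynomial_function_measurable[OF p(1)]
      by (simp_all add: measurable_cong_sets[OF M(2) refl] M(2))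
    have "(\<integral>\<^sup>+x. ennreal ((g x - p x)\<^sup>2) \<partial>M)
        \<le> 2 * (\<integral>\<^sup>+x. ennreal ((g x - U i x)\<^sup>2) \<partial>M) + 2 * (\<integral>\<^sup>+x. ennreal ((U i x - p x)\<^sup>2) \<partial>M)"
      by (intro nn_integral_square_triangle) auto
    also have "\<dots> < ennreal e"
      using ennreal_two_quarters_less[OF e i p(2)] .
    finally show "\<exists>p. real_polynomial_function p \<and> (\<integral>\<^sup>+x. ennreal ((g x - p x)\<^sup>2) \<partial>M) < ennreal e"
      using p(1) by blast
  qed
qed

lemma finite_borel_poly_dense:
  fixes M :: "real measure" and g :: "real \<Rightarrow> real"
  assumes M: "finite_measure M" "sets M = sets borel" "emeasure M (- {a..b}) = 0"
    and g: "g \<in> borel_measurable borel" "\<And>x. \<bar>g x\<bar> \<le> B" and e: "e > 0"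
  shows "\<exists>p. real_polynomial_function p \<and> (\<integral>\<^sup>+x. ennreal ((g x - p x)\<^sup>2) \<partial>M) < ennreal e"
proof -
  have *: "0 \<le> g x + B" "g x + B \<le> 2 * B" for x using g(2)[of x] by auto
  have gm: "(\<lambda>x. g x + B) \<in> borel_measurable borel" using g(1) by simp
  obtain p where p: "real_polynomial_function p"
      "(\<integral>\<^sup>+x. ennreal (((g x + B) - p x)\<^sup>2) \<partial>M) < ennreal e"
    using finite_borel_poly_dense_nonneg[OF M gm *(1), THEN mp, OF exI[of _ "2 * B"], THEN spec[of _ e],
        THEN mp]
      * e by auto
  show ?thesis
    by (rule exI[of _ "\<lambda>x. p x - B"])
       (use p in \<open>auto simp: algebra_simps\<close>)
qed

text \<open>
  The same polynomial serves for two measures, since it can be chosen for their sum, which dominates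
  both.
\<close>

lemma finite_borel_poly_dense_pair:
  fixes M N :: "real measure" and g :: "real \<Rightarrow> real"
  assumes M: "finite_measure M" "sets M = sets borel" "emeasure M (- {a..b}) = 0"
    and N: "finite_measure N" "sets N = sets borel" "emeasure N (- {a..b}) = 0"
    and g: "g \<in> borel_measurable borel" "\<And>x. \<bar>g x\<bar> \<le> B" and e: "e > 0"
  shows "\<exists>p. real_polynomial_function p \<and> (\<integral>\<^sup>+x. ennreal ((g x - p x)\<^sup>2) \<partial>M) < ennreal e
     \<and> (\<integral>\<^sup>+x. ennreal ((g x - p x)\<^sup>2) \<partial>N) < ennreal e"
proof -
  define S where "S = measure_of UNIV (sets (borel :: real measure)) (\<lambda>E. emeasure M E + emeasure N E)"
  have sS: "sets S = sets borel" unfolding S_def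
    using sets.sigma_sets_eq[of "borel :: real measure"] by (simp add: sets_measure_of)
  have eS: "emeasure S E = emeasure M E + emeasure N E" if "E \<in> sets borel" for E
  proof (rule emeasure_measure_of[OF S_def])
    show "positive (sets S) (\<lambda>E. emeasure M E + emeasure N E)" by (simp add: positive_def)
    show "countably_additive (sets S) (\<lambda>E. emeasure M E + emeasure N E)"
    proof (rule countably_additiveI)
      fix F :: "nat \<Rightarrow> real set" assume F: "range F \<subseteq> sets S" "disjoint_family F"
      then have "(\<Sum>i. emeasure M (F i)) = emeasure M (\<Union>i. F i)"
        "(\<Sum>i. emeasure N (F i)) = emeasure N (\<Union>i. F i)"
        using M(2) N(2) sS by (simp_all add: suminf_emeasure)
      then show "(\<Sum>i. emeasure M (F i) + emeasure N (F i)) = emeasure M (\<Union>i. F i) + emeasure N (\<Union>i. F i)"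
        by (simp add: suminf_add[symmetric])
    qed
  qed (use that sS in auto)
  have fS: "finite_measure S"
    by (rule finite_measureI)
       (use finite_measure.emeasure_finite[OF M(1)] finite_measure.emeasure_finite[OF N(1)] in
         \<open>simp add: sets_eq_imp_space_eq[OF sS] eS\<close>)
  obtain p where p: "real_polynomial_function p"
      "(\<integral>\<^sup>+x. ennreal ((g x - p x)\<^sup>2) \<partial>S) < ennreal e"
    using finite_borel_poly_dense[OF fS sS _ g e, of a b] eS M(3) N(3) by auto
  have "(\<integral>\<^sup>+x. h x \<partial>M) \<le> (\<integral>\<^sup>+x. h x \<partial>S)" "(\<integral>\<^sup>+x. h x \<partial>N) \<le> (\<integral>\<^sup>+x. h x \<partial>S)" for h
    by (rule nn_integral_mono_measure; use M(2) N(2) sS eS in \<open>auto simp: le_measure\<close>)+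
  then show ?thesis using p by (blast intro: order_le_less_trans)
qed

section \<open>Polynomial test functions and smooth functions\<close>

text \<open>
  If the sign of \<open>w\<close> were a polynomial \<open>q\<close>, the hypothesis would read \<open>\<integral> \<bar>w\<bar> = 0\<close>. It is at least a limit of
  polynomials in \<open>L\<^sup>2\<close> of the finite measure with density \<open>\<bar>w\<bar>\<close>, and
  \<open>\<integral> \<bar>w\<bar> = \<integral> w (sgn w - q)\<close> is at most the \<open>L\<^sup>1\<close> distance of \<open>sgn w\<close> and \<open>q\<close> for that measure.
\<close>

lemma AE_zero_if_integral_poly_zero:
  fixes w :: "real \<Rightarrow> real"
  assumes w: "integrable lborel w" and supp: "\<And>x. x \<notin> {c..d} \<Longrightarrow> w x = 0"
    and orth: "\<And>q. real_polynomial_function q \<Longrightarrow> (LINT x|lborel. w x * q x) = 0"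
  shows "AE x in lborel. w x = 0"
proof -
  have [measurable]: "w \<in> borel_measurable borel" using w by auto
  define m where "m = density lborel (\<lambda>x. ennreal \<bar>w x\<bar>)"
  have sm: "sets m = sets borel" by (simp add: m_def)
  have nn_m: "(\<integral>\<^sup>+x. h x \<partial>m) = (\<integral>\<^sup>+x. ennreal \<bar>w x\<bar> * h x \<partial>lborel)"
    if "h \<in> borel_measurable borel" for h
    unfolding m_def using that by (subst nn_integral_density) auto
  define C where "C = (LINT x|lborel. \<bar>w x\<bar>)"
  have C0: "0 \<le> C" by (simp add: C_def)
  have mU: "emeasure m UNIV = ennreal C"
    using w by (simp add: m_def emeasure_density C_def nn_integral_eq_integral)
  have fm: "finite_measure m"
    by (rule finite_measureI) (use mU in \<open>simp add: m_def\<close>)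
  have conc: "emeasure m (- {c..d}) = 0"
    by (simp add: m_def emeasure_density nn_integral_0_iff_AE supp split: split_indicator)
  have "C\<^sup>2 \<le> e * C" if e: "e > 0" for e
  proof -
    obtain q where q: "real_polynomial_function q"
        "(\<integral>\<^sup>+x. ennreal ((sgn (w x) - q x)\<^sup>2) \<partial>m) < ennreal e"
      using finite_borel_poly_dense[OF fm sm conc, of "\<lambda>x. sgn (w x)" 1 e] e by (auto simp: abs_sgn_eq)
    have [measurable]: "q \<in> borel_measurable borel"
      using q(1) by (rule real_polynomial_function_measurable)
    have q_bdd: "\<exists>B. \<forall>x\<in>{c..d}. \<bar>q x\<bar> \<le> B"
    proof -
      have "continuous_on {c..d} q"
        using q(1) by (simp add: continuous_on_polymonial_function real_polynomial_function_eq)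
      from compact_imp_bounded[OF compact_continuous_image[OF this compact_Icc]]
      show ?thesis by (auto simp: bounded_iff)
    qed
    then obtain B where B: "\<And>x. x \<in> {c..d} \<Longrightarrow> \<bar>q x\<bar> \<le> B" by blast
    have wq: "integrable lborel (\<lambda>x. w x * q x)"
    proof (rule Bochner_Integration.integrable_bound[OF integrable_mult_right[OF w, of B]])
      show "AE x in lborel. norm (w x * q x) \<le> norm (B * w x)"
      proof (intro AE_I2)
        fix x show "norm (w x * q x) \<le> norm (B * w x)"
        proof (cases "x \<in> {c..d}")
          case True
          from B[OF this] show ?thesis by (simp add: abs_mult mult.commute mult_right_mono)
        qed (simp add: supp)
      qed
    qed simp
    have "C = (LINT x|lborel. w x * sgn (w x))" by (simp add: C_def abs_sgn)
    also have "\<dots> = (LINT x|lborel. w x * sgn (w x) - w x * q x)"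
      using w wq orth[OF q(1)] by (subst Bochner_Integration.integral_diff) (auto simp: abs_sgn[symmetric])
    also have "\<dots> \<le> (LINT x|lborel. \<bar>w x\<bar> * \<bar>sgn (w x) - q x\<bar>)"
    proof (rule integral_mono)
      have "integrable lborel (\<lambda>x. \<bar>w x * sgn (w x) - w x * q x\<bar>)"
        using w wq by (intro integrable_abs Bochner_Integration.integrable_diff) (auto
            simp: abs_sgn[symmetric])
      then show "integrable lborel (\<lambda>x. \<bar>w x\<bar> * \<bar>sgn (w x) - q x\<bar>)"
        by (simp add: abs_mult[symmetric] right_diff_distrib)
      show "integrable lborel (\<lambda>x. w x * sgn (w x) - w x * q x)"
        using w wq by (intro Bochner_Integration.integrable_diff) (auto simp: abs_sgn[symmetric])
    qed (simp add: abs_mult[symmetric] right_diff_distrib)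
    also have "\<dots> = enn2real (\<integral>\<^sup>+x. ennreal (\<bar>w x\<bar> * \<bar>sgn (w x) - q x\<bar>) \<partial>lborel)"
      by (rule integral_eq_nn_integral) auto
    also have "\<dots> = enn2real (\<integral>\<^sup>+x. ennreal \<bar>sgn (w x) - q x\<bar> * 1 \<partial>m)"
      by (simp add: nn_m ennreal_mult)
    finally have "C \<le> enn2real (\<integral>\<^sup>+x. ennreal \<bar>sgn (w x) - q x\<bar> * 1 \<partial>m)" .
    then have "ennreal C \<le> (\<integral>\<^sup>+x. ennreal \<bar>sgn (w x) - q x\<bar> * 1 \<partial>m)"
      using C0 by (metis enn2real_nonneg ennreal_enn2real_if ennreal_leI ennreal_le_iff2 top_greatest)
    then have "(ennreal C)\<^sup>2 \<le> (\<integral>\<^sup>+x. ennreal \<bar>sgn (w x) - q x\<bar> * 1 \<partial>m)\<^sup>2"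
      by (rule power_mono_ennreal)
    also have "\<dots> \<le> (\<integral>\<^sup>+x. (ennreal \<bar>sgn (w x) - q x\<bar>)\<^sup>2 \<partial>m) * (\<integral>\<^sup>+x. 1\<^sup>2 \<partial>m)"
      by (rule Cauchy_Schwarz_nn_integral) (simp_all add: measurable_cong_sets[OF sm refl])
    also have "\<dots> = (\<integral>\<^sup>+x. ennreal ((sgn (w x) - q x)\<^sup>2) \<partial>m) * ennreal C"
      using mU by (simp add: ennreal_power m_def)
    also have "\<dots> \<le> ennreal e * ennreal C"
      using q(2) by (intro mult_right_mono) auto
    finally have "ennreal (C\<^sup>2) \<le> ennreal (e * C)"
      using C0 e by (simp add: ennreal_power ennreal_mult)
    then show ?thesis using C0 e by (simp add: ennreal_le_iff)
  qed
  \<comment> \<open>For \<open>C > 0\<close> the choice \<open>e = C/2\<close> would give \<open>C\<^sup>2 \<le> C\<^sup>2/2\<close>.\<close>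
  from this[of "C/2"] have "C = 0" using C0
    by (cases "C = 0") (auto simp: power2_eq_square)
  then show ?thesis using w unfolding C_def
    by (subst (asm) integral_nonneg_eq_0_iff_AE) auto
qed

lemma smooth_closure_real_polynomial_function:
  assumes "real_polynomial_function p"
  shows "smooth_closure S p"
proof -
  define D where "D = rec_nat p (\<lambda>_ q. SOME q'
      . real_polynomial_function q' \<and> (\<forall>x. (q has_real_derivative q' x) (at x)))"
  have D0: "D 0 = p" and DS: "D (Suc n) = (SOME q'
      . real_polynomial_function q' \<and> (\<forall>x. (D n has_real_derivative q' x) (at x)))" for n
    by (simp_all add: D_def)
  have rD: "real_polynomial_function (D n)" for n
  proof (induction n)
    case (Suc n)
    show ?case unfolding DS
      using someI_ex[OF has_real_derivative_polynomial_function[OF Suc]] by blast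
  qed (simp add: D0 assms)
  have dD: "(D n has_real_derivative D (Suc n) x) (at x)" for n x
    unfolding DS using someI_ex[OF has_real_derivative_polynomial_function[OF rD[of n]]] by blast
  show ?thesis unfolding smooth_closure_def
    by (rule exI[of _ D]) (use dD D0 in \<open>auto intro: DERIV_subset\<close>)
qed

lemma real_polynomial_function_antiderivative:
  assumes "real_polynomial_function p"
  shows "\<exists>u. real_polynomial_function u \<and> (\<forall>x. (u has_real_derivative p x) (at x)) \<and> u a = 0"
proof -
  obtain c n where p: "p = (\<lambda>x. \<Sum>i\<le>n. c i * x ^ i)"
    using assms by (auto simp: real_polynomial_function_iff_sum)
  define u where "u x = (\<Sum>i\<le>n. c i / (1 + real i) * x ^ Suc i)" for x
  have "real_polynomial_function u" unfolding u_def
    by (intro real_polynomial_function_sum real_polynomial_function.intros real_polynomial_function_power)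
       (auto intro: bounded_linear_ident)
  moreover have "(u has_real_derivative p x) (at x)" for x
    unfolding u_def p
    by (rule derivative_eq_intros refl sum.cong | simp)+
  ultimately show ?thesis
    by (intro exI[of _ "\<lambda>x. u x - u a"])
       (auto intro!: derivative_eq_intros simp: real_polynomial_function.intros
           real_polynomial_function_diff)
qed

text \<open>
  Smoothness up to the boundary is expressed by one-sided derivatives on the closure; this recovers the
  ordinary derivative inside the interval.
\<close>

lemma smooth_closure_derivative:
  assumes "smooth_closure {a<..<b} u" "a < b"
  shows "\<exists>D. (\<forall>x\<in>{a<..<b}. deriv u x = D x) \<and> continuous_on {a<..<b} D \<and>
    (\<forall>x\<in>{a<..<b}. (u has_real_derivative D x) (at x))"
proof -
  have cl: "closure {a<..<b} = {a..b}" using assms(2) by simp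
  obtain D where D: "\<And>x. x \<in> {a..b} \<Longrightarrow> D 0 x = u x"
     "\<And>n x. x \<in> {a..b} \<Longrightarrow> (D n has_real_derivative D (Suc n) x) (at x within {a..b})"
    using assms unfolding smooth_closure_def cl by blast
  have at: "at x within {a..b} = at x" if "x \<in> {a<..<b}" for x
    using that by (intro at_within_interior) auto
  have d: "(D n has_real_derivative D (Suc n) x) (at x)" if "x \<in> {a<..<b}" for n x
    using D(2)[of x n] that by (simp add: at)
  have du: "(u has_real_derivative D (Suc 0) x) (at x)" if "x \<in> {a<..<b}" for x
  proof (rule has_field_derivative_transform_within_open[OF d[OF that]])
    show "D 0 y = u y" if "y \<in> {a<..<b}" for y using D(1)[of y] that by auto
  qed (use that in auto)
  show ?thesis
  proof (intro exI[of _ "D (Suc 0)"] conjI ballI)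
    show "continuous_on {a<..<b} (D (Suc 0))"
      using d by (intro continuous_at_imp_continuous_on ballI DERIV_isCont)
  qed (use du in \<open>auto intro: DERIV_imp_deriv\<close>)
qed

text \<open>
  Integration by parts; the boundary terms disappear because \<open>\<phi>\<close> vanishes at both ends.
\<close>

lemma integral_deriv_mult_test_function:
  fixes u \<phi> \<phi>' :: "real \<Rightarrow> real"
  assumes u: "smooth_closure {a<..<b} u" and cd: "a < c" "c \<le> d" "d < b"
    and \<phi>: "\<And>x. (\<phi> has_real_derivative \<phi>' x) (at x)" "continuous_on {c..d} \<phi>'" "\<phi> c = 0" "\<phi> d = 0"
  shows "(LINT x|lborel. indicator {c..d} x * deriv u x * \<phi> x)
      = - (LINT x|lborel. indicator {c..d} x * u x * \<phi>' x)"
proof -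
  have "a < b" using cd by simp
  obtain D where D: "\<And>x. x \<in> {a<..<b} \<Longrightarrow> deriv u x = D x" "continuous_on {a<..<b} D"
    "\<And>x. x \<in> {a<..<b} \<Longrightarrow> (u has_real_derivative D x) (at x)"
    using smooth_closure_derivative[OF u \<open>a < b\<close>] by blast
  have sub: "{c..d} \<subseteq> {a<..<b}" using cd by auto
  have cD: "continuous_on {c..d} D" using D(2) sub by (rule continuous_on_subset)
  have cu: "continuous_on {c..d} u" using D(3) sub
    by (intro continuous_at_imp_continuous_on ballI DERIV_isCont[OF D(3)]) auto
  have c\<phi>: "continuous_on {c..d} \<phi>"
    by (intro continuous_at_imp_continuous_on ballI DERIV_isCont[OF \<phi>(1)])
  have i: "integrable lborel (\<lambda>x. indicator {c..d} x *\<^sub>R (D x * \<phi> x))"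
       "integrable lborel (\<lambda>x. indicator {c..d} x *\<^sub>R (u x * \<phi>' x))"
    by (intro borel_integrable_compact continuous_intros cD cu c\<phi> \<phi>(2) compact_Icc)+
  have "(LINT x|lborel. indicator {c..d} x *\<^sub>R (D x * \<phi> x + u x * \<phi>' x)) = u d * \<phi> d - u c * \<phi> c"
  proof (rule integral_FTC_Icc[OF cd(2)])
    fix x assume "c \<le> x" "x \<le> d"
    then have "((\<lambda>x. u x * \<phi> x) has_real_derivative D x * \<phi> x + u x * \<phi>' x) (at x)"
      using D(3)[of x] \<phi>(1)[of x] cd by (auto intro!: derivative_eq_intros)
    then show "((\<lambda>x. u x * \<phi> x) has_vector_derivative D x * \<phi> x + u x * \<phi>' x) (at x within {c..d})"
      by (simp add: has_real_derivative_iff_has_vector_derivative has_vector_derivative_at_within)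
  qed (intro continuous_intros cD cu c\<phi> \<phi>(2))
  also have "\<dots> = 0" using \<phi> by simp
  finally have "(LINT x|lborel. indicator {c..d} x *\<^sub>R (D x * \<phi> x))
      + (LINT x|lborel. indicator {c..d} x *\<^sub>R (u x * \<phi>' x)) = 0"
    by (subst Bochner_Integration.integral_add[OF i, symmetric]) (simp only: scaleR_add_right)
  moreover have "(LINT x|lborel. indicator {c..d} x * deriv u x * \<phi> x)
      = (LINT x|lborel. indicator {c..d} x *\<^sub>R (D x * \<phi> x))"
    using D(1) sub by (intro Bochner_Integration.integral_cong) (auto split: split_indicator)
  ultimately show ?thesis by (simp add: mult.assoc)
qed

section \<open>Elementary facts on \<open>L\<^sup>2\<close>\<close>

lemma L2_diff:
  assumes "u \<in> L2 \<mu>" "v \<in> L2 \<mu>"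
  shows "(\<lambda>x. u x - v x) \<in> L2 \<mu>"
proof -
  have "integrable \<mu> (\<lambda>x. (u x)\<^sup>2 + (v x)\<^sup>2 - 2 * (u x * v x))"
    using assms L2_mult_integrable[OF assms] by (auto simp: L2_def)
  then have "integrable \<mu> (\<lambda>x. (u x - v x)\<^sup>2)"
    by (simp add: power2_diff mult.assoc)
  then show ?thesis using assms by (auto simp: L2_def)
qed

lemma nn_integral_square_L2:
  assumes "w \<in> L2 \<mu>"
  shows "(\<integral>\<^sup>+x. ennreal ((w x)\<^sup>2) \<partial>\<mu>) = ennreal ((L2_norm \<mu> w)\<^sup>2)"
proof -
  have "0 \<le> L2_inner \<mu> w w" unfolding L2_inner_def
    by (intro integral_nonneg_AE) simp
  then show ?thesis using assms
    by (subst nn_integral_eq_integral) (auto simp: L2_def L2_norm_def L2_inner_def power2_eq_square)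
qed

section \<open>A finite measure with density off a null set\<close>

text \<open>
  The last assumption condenses the decomposition of \<open>\<mu>\<close>: on Borel sets that avoid \<open>A\<close> the singular part
  is zero, so that \<open>\<mu>\<close> has density \<open>f\<close> there.
\<close>

locale weighted_interval =
  fixes a b :: real and I A :: "real set" and \<mu> :: "real measure" and f :: "real \<Rightarrow> ennreal"
  assumes ab: "a < b" and I_eq: "I = {a<..<b}"
    and fin: "finite_measure \<mu>" and sets_\<mu>: "sets \<mu> = sets (restrict_space borel I)"
    and A_borel [measurable]: "A \<in> sets borel" and A_sub: "A \<subseteq> I" and A_null: "emeasure lborel A = 0"
    and f_meas: "f \<in> borel_measurable (restrict_space lborel I)"
    and emeasure_off_A: "\<And>E. E \<in> sets borel \<Longrightarrow> E \<subseteq> I - A \<Longrightarrow> emeasure \<mu> E = (\<integral>\<^sup>+x\<in>E. f x \<partial>lborel)"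
begin

text \<open>
  Cutting off outside \<open>I\<close> gives a function that is Borel measurable on the whole line.
\<close>

definition F :: "real \<Rightarrow> ennreal" where "F x = f x * indicator I x"

text \<open>
  The same measure regarded as a measure on the whole line, to which regularity theorems apply.
\<close>

definition \<mu>R :: "real measure" where "\<mu>R = distr \<mu> borel (\<lambda>x. x)"

abbreviation M :: "real set" where "M \<equiv> degenerate_set I f"

lemma I_borel [measurable]: "I \<in> sets borel" by (simp add: I_eq)

lemma space_\<mu>: "space \<mu> = I"
  using sets_eq_imp_space_eq[OF sets_\<mu>] by (simp add: space_restrict_space)

lemma F_meas [measurable]: "F \<in> borel_measurable borel"
  using f_meas unfolding F_def
  by (subst (asm) borel_measurable_restrict_space_iff_ennreal) auto

lemma measurable_\<mu>: "h \<in> borel_measurable borel \<Longrightarrow> h \<in> borel_measurable \<mu>"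
  by (subst measurable_cong_sets[OF sets_\<mu> refl]) (rule measurable_restrict_space1)

lemma measurable_\<mu>_indicator:
  assumes "h \<in> borel_measurable \<mu>"
  shows "(\<lambda>x. indicator I x * h x :: real) \<in> borel_measurable borel"
  using assms unfolding measurable_cong_sets[OF sets_\<mu> refl]
  by (subst (asm) borel_measurable_restrict_space_iff) auto

lemma id_meas [measurable]: "(\<lambda>x. x) \<in> measurable \<mu> borel"
  by (subst measurable_cong_sets[OF sets_\<mu> refl]) (rule measurable_restrict_space1, simp)

lemma sets_\<mu>R [simp]: "sets \<mu>R = sets borel" and space_\<mu>R [simp]: "space \<mu>R = UNIV"
  by (simp_all add: \<mu>R_def)

lemma finite_\<mu>R: "finite_measure \<mu>R"
  unfolding \<mu>R_def by (intro finite_measure.finite_measure_distr fin id_meas)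

lemma emeasure_\<mu>R: "E \<in> sets borel \<Longrightarrow> emeasure \<mu>R E = emeasure \<mu> (E \<inter> I)"
  unfolding \<mu>R_def by (subst emeasure_distr) (auto simp: space_\<mu>)

lemma nn_integral_\<mu>R: "h \<in> borel_measurable borel \<Longrightarrow> (\<integral>\<^sup>+x. h x \<partial>\<mu>R) = (\<integral>\<^sup>+x. h x \<partial>\<mu>)"
  unfolding \<mu>R_def by (subst nn_integral_distr) auto

lemma conc_\<mu>R: "emeasure \<mu>R (- {a..b}) = 0"
proof -
  have "- {a..b} \<inter> I = {}" by (auto simp: I_eq)
  then show ?thesis by (subst emeasure_\<mu>R) auto
qed

lemma AE_off_A: "AE x in lborel. x \<notin> A"
  using A_null by (subst AE_iff_measurable[of A]) auto

text \<open>
  Off \<open>A\<close> integrals for \<open>\<mu>\<close> are Lebesgue integrals with weight \<open>f\<close>; \<open>A\<close> reappears on the right because it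
  is Lebesgue null.
\<close>

lemma nn_integral_off_A:
  assumes h [measurable]: "h \<in> borel_measurable borel"
  shows "(\<integral>\<^sup>+x. h x * indicator (- A) x \<partial>\<mu>) = (\<integral>\<^sup>+x. h x * F x \<partial>lborel)"
proof -
  have eq: "density \<mu>R (indicator (- A)) = density lborel F"
  proof (rule measure_eqI)
    fix E assume "E \<in> sets (density \<mu>R (indicator (- A)))"
    then have [measurable]: "E \<in> sets borel" by simp
    have "emeasure (density \<mu>R (indicator (- A))) E = (\<integral>\<^sup>+x. indicator (- A \<inter> E) x \<partial>\<mu>R)"
      by (subst emeasure_density)
         (auto intro!: nn_integral_cong simp: measurable_cong_sets[OF sets_\<mu>R refl]
             split: split_indicator simp del: nn_integral_indicator)
    also have "\<dots> = emeasure \<mu> (- A \<inter> E \<inter> I)" by (simp add: emeasure_\<mu>R)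
    also have "\<dots> = (\<integral>\<^sup>+x\<in>- A \<inter> E \<inter> I. f x \<partial>lborel)"
      by (rule emeasure_off_A) auto
    also have "\<dots> = (\<integral>\<^sup>+x\<in>E. F x \<partial>lborel)"
      using AE_off_A by (intro nn_integral_cong_AE, elim AE_mp) (auto simp: F_def intro!: AE_I2
          split: split_indicator)
    also have "\<dots> = emeasure (density lborel F) E"
      by (subst emeasure_density) auto
    finally show "emeasure (density \<mu>R (indicator (- A))) E = emeasure (density lborel F) E" .
  qed simp
  have "(\<integral>\<^sup>+x. h x * indicator (- A) x \<partial>\<mu>) = (\<integral>\<^sup>+x. indicator (- A) x * h x \<partial>\<mu>R)"
    by (subst nn_integral_\<mu>R) (auto simp: mult.commute)
  also have "\<dots> = (\<integral>\<^sup>+x. h x \<partial>density \<mu>R (indicator (- A)))"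
    by (subst nn_integral_density) (auto simp: measurable_cong_sets[OF sets_\<mu>R refl])
  also have "\<dots> = (\<integral>\<^sup>+x. F x * h x \<partial>lborel)"
    unfolding eq by (subst nn_integral_density) auto
  finally show ?thesis by (simp add: mult.commute)
qed

lemma AE_F_finite: "AE x in lborel. F x \<noteq> \<infinity>"
proof -
  have "(\<integral>\<^sup>+x. F x \<partial>lborel) = (\<integral>\<^sup>+x. 1 * indicator (- A) x \<partial>\<mu>)"
    by (subst nn_integral_off_A) auto
  also have "\<dots> \<le> (\<integral>\<^sup>+x. 1 \<partial>\<mu>)" by (intro nn_integral_mono) (auto split: split_indicator)
  also have "\<dots> < \<infinity>" using finite_measure.emeasure_finite[OF fin] by (simp add: top.not_eq_extremum)
  finally show ?thesis by (intro nn_integral_noteq_infinite) auto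
qed

section \<open>Gradients of zero vanish where the weight is non-degenerate\<close>

text \<open>
  Formally this is Cauchy-Schwarz for \<open>\<bar>w\<bar> = (\<bar>w\<bar> \<surd>f) (1 / \<surd>f)\<close>. To do without square roots of extended
  reals it is applied to \<open>\<bar>w\<bar>\<close> and \<open>1/f\<close> with respect to the measure \<open>f dx\<close>; this needs \<open>f \<cdot> (1/f) = 1\<close>
  almost everywhere, which holds because \<open>f\<close> and \<open>1/f\<close> are both finite almost everywhere on \<open>[c, d]\<close>.
\<close>

lemma L1_sq_le_L2_sq_times_resistance:
  assumes [measurable]: "w \<in> borel_measurable borel" and cd: "{c..d} \<subseteq> I"
    and G: "(\<integral>\<^sup>+x\<in>{c..d}. 1 / f x \<partial>lborel) < \<infinity>"
  shows "(\<integral>\<^sup>+x\<in>{c..d}. ennreal \<bar>w x\<bar> \<partial>lborel)\<^sup>2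
     \<le> (\<integral>\<^sup>+x. ennreal ((w x)\<^sup>2) \<partial>\<mu>) * (\<integral>\<^sup>+x\<in>{c..d}. 1 / f x \<partial>lborel)"
proof -
  let ?J = "indicator {c..d} :: real \<Rightarrow> ennreal"
  have G_eq: "(\<integral>\<^sup>+x\<in>{c..d}. 1 / f x \<partial>lborel) = (\<integral>\<^sup>+x. 1 / F x * ?J x \<partial>lborel)"
    using cd by (intro nn_integral_cong) (auto simp: F_def split: split_indicator)
  have "AE x in lborel. 1 / F x * ?J x \<noteq> \<infinity>"
    using G unfolding G_eq by (intro nn_integral_noteq_infinite) auto
  with AE_F_finite have inv: "AE x in lborel. x \<in> {c..d} \<longrightarrow> F x * (1 / F x) = 1"
  proof eventually_elim
    case (elim x)
    show ?case
    proof
      assume "x \<in> {c..d}"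
      then have "F x \<noteq> 0" "F x \<noteq> top" using elim by (auto simp: ennreal_divide_zero)
      then show "F x * (1 / F x) = 1"
        by (simp add: ennreal_times_divide top.not_eq_extremum ennreal_divide_self)
    qed
  qed
  define \<nu> where "\<nu> = density lborel F"
  have nu: "(\<integral>\<^sup>+x. h x \<partial>\<nu>) = (\<integral>\<^sup>+x. F x * h x \<partial>lborel)" if "h \<in> borel_measurable borel" for h
    unfolding \<nu>_def using that by (subst nn_integral_density) auto
  have "(\<integral>\<^sup>+x\<in>{c..d}. ennreal \<bar>w x\<bar> \<partial>lborel)
      = (\<integral>\<^sup>+x. F x * ((ennreal \<bar>w x\<bar> * ?J x) * (1 / F x * ?J x)) \<partial>lborel)"
  proof (rule nn_integral_cong_AE, use inv in eventually_elim)
    case (elim x)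
    have "F x * (ennreal \<bar>w x\<bar> * (1 / F x)) = (F x * (1 / F x)) * ennreal \<bar>w x\<bar>"
      by (simp only: mult_ac)
    then show ?case using elim by (auto split: split_indicator)
  qed
  also have "\<dots> = (\<integral>\<^sup>+x. (ennreal \<bar>w x\<bar> * ?J x) * (1 / F x * ?J x) \<partial>\<nu>)"
    by (subst nu) auto
  finally have "(\<integral>\<^sup>+x\<in>{c..d}. ennreal \<bar>w x\<bar> \<partial>lborel)\<^sup>2 = (\<integral>\<^sup>+x. (ennreal \<bar>w x\<bar> * ?J x) * (1 / F x * ?J x) \<partial>\<nu>)\<^sup>2"
    by simp
  also have "\<dots> \<le> (\<integral>\<^sup>+x. (ennreal \<bar>w x\<bar> * ?J x)\<^sup>2 \<partial>\<nu>) * (\<integral>\<^sup>+x. (1 / F x * ?J x)\<^sup>2 \<partial>\<nu>)"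
    by (rule Cauchy_Schwarz_nn_integral) (simp_all add: \<nu>_def)
  also have "(\<integral>\<^sup>+x. (1 / F x * ?J x)\<^sup>2 \<partial>\<nu>) = (\<integral>\<^sup>+x. F x * (1 / F x * ?J x)\<^sup>2 \<partial>lborel)"
    by (subst nu) auto
  also have "\<dots> = (\<integral>\<^sup>+x\<in>{c..d}. 1 / f x \<partial>lborel)"
    unfolding G_eq
  proof (rule nn_integral_cong_AE, use inv in eventually_elim)
    case (elim x)
    have "F x * (1 / F x)\<^sup>2 = (F x * (1 / F x)) * (1 / F x)"
      by (simp only: power2_eq_square mult.assoc)
    then show ?case using elim by (auto split: split_indicator)
  qed
  also have "(\<integral>\<^sup>+x. (ennreal \<bar>w x\<bar> * ?J x)\<^sup>2 \<partial>\<nu>) = (\<integral>\<^sup>+x. (ennreal ((w x)\<^sup>2) * ?J x) * F x \<partial>lborel)"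
    by (subst nu) (auto intro!: nn_integral_cong simp: ennreal_power mult.commute split: split_indicator)
  also have "\<dots> = (\<integral>\<^sup>+x. (ennreal ((w x)\<^sup>2) * ?J x) * indicator (- A) x \<partial>\<mu>)"
    by (rule nn_integral_off_A[symmetric]) auto
  also have "\<dots> \<le> (\<integral>\<^sup>+x. ennreal ((w x)\<^sup>2) \<partial>\<mu>)"
    by (intro nn_integral_mono) (auto split: split_indicator)
  finally show ?thesis by (simp add: mult_right_mono)
qed

lemma L2_imp_L1_on_nondegenerate:
  assumes w: "w \<in> L2 \<mu>" and cd: "{c..d} \<subseteq> I"
    and G: "(\<integral>\<^sup>+x\<in>{c..d}. 1 / f x \<partial>lborel) = ennreal K" and K: "K \<ge> 0"
  shows "integrable lborel (\<lambda>x. indicator {c..d} x * w x)"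
    and "(LINT x|lborel. \<bar>indicator {c..d} x * w x\<bar>) \<le> L2_norm \<mu> w * sqrt K"
proof -
  have [measurable]: "w \<in> borel_measurable \<mu>" using w by (simp add: L2_def)
  define w' where "w' x = indicator I x * w x" for x
  have [measurable]: "w' \<in> borel_measurable borel"
    unfolding w'_def by (rule measurable_\<mu>_indicator) simp
  have eq: "(\<lambda>x. indicator {c..d} x * w x) = (\<lambda>x. indicator {c..d} x * w' x)"
    using cd by (auto simp: w'_def fun_eq_iff split: split_indicator)
  have n0: "0 \<le> L2_norm \<mu> w" unfolding L2_norm_def L2_inner_def by (simp add: integral_nonneg_AE)
  have "(\<integral>\<^sup>+x. ennreal \<bar>indicator {c..d} x * w x\<bar> \<partial>lborel) = (\<integral>\<^sup>+x\<in>{c..d}. ennreal \<bar>w' x\<bar> \<partial>lborel)"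
  proof (intro nn_integral_cong)
    fix x show "ennreal \<bar>indicator {c..d} x * w x\<bar> = ennreal \<bar>w' x\<bar> * indicator {c..d} x"
      using fun_cong[OF eq, of x] by (auto split: split_indicator)
  qed
  moreover have "(\<integral>\<^sup>+x\<in>{c..d}. ennreal \<bar>w' x\<bar> \<partial>lborel)\<^sup>2 \<le> ennreal ((L2_norm \<mu> w * sqrt K)\<^sup>2)"
  proof -
    have "(\<integral>\<^sup>+x. ennreal ((w' x)\<^sup>2) \<partial>\<mu>) = (\<integral>\<^sup>+x. ennreal ((w x)\<^sup>2) \<partial>\<mu>)"
      by (intro nn_integral_cong) (simp add: space_\<mu> w'_def)
    then show ?thesis
      using L1_sq_le_L2_sq_times_resistance[of w' c d] cd G K nn_integral_square_L2[OF w]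
      by (simp add: power_mult_distrib ennreal_mult)
  qed
  ultimately have le: "(\<integral>\<^sup>+x. ennreal \<bar>indicator {c..d} x * w x\<bar> \<partial>lborel) \<le> ennreal (L2_norm \<mu> w * sqrt K)"
    using n0 K by (cases "\<integral>\<^sup>+x\<in>{c..d}. ennreal \<bar>w' x\<bar> \<partial>lborel")
      (auto simp: ennreal_power ennreal_le_iff power_mono_iff top_power_ennreal top_unique)
  show int: "integrable lborel (\<lambda>x. indicator {c..d} x * w x)"
  proof (rule integrableI_bounded)
    show "(\<lambda>x. indicator {c..d} x * w x) \<in> borel_measurable lborel" unfolding eq by simp
    show "(\<integral>\<^sup>+x. ennreal (norm (indicator {c..d} x * w x)) \<partial>lborel) < \<infinity>"
      using le by (simp add: order_le_less_trans)
  qed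
  have "ennreal (LINT x|lborel. \<bar>indicator {c..d} x * w x\<bar>) \<le> ennreal (L2_norm \<mu> w * sqrt K)"
    using le int by (subst (asm) nn_integral_eq_integral) auto
  then show "(LINT x|lborel. \<bar>indicator {c..d} x * w x\<bar>) \<le> L2_norm \<mu> w * sqrt K"
    using n0 K by (simp add: ennreal_le_iff)
qed

text \<open>
  On an interval where \<open>1/f\<close> is integrable, convergence in \<open>L\<^sup>2(\<mu>)\<close> implies convergence in Lebesgue \<open>L\<^sup>1\<close>, and
  hence convergence of the integrals against a continuous function.
\<close>

lemma L2_tendsto_weak:
  assumes u: "L2_tendsto \<mu> u w" and cd: "{c..d} \<subseteq> I"
    and G: "(\<integral>\<^sup>+x\<in>{c..d}. 1 / f x \<partial>lborel) < \<infinity>" and \<phi>: "continuous_on UNIV \<phi>"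
  shows "(\<lambda>n. LINT x|lborel. indicator {c..d} x * u n x * \<phi> x)
      \<longlonglongrightarrow> (LINT x|lborel. indicator {c..d} x * w x * \<phi> x)"
proof -
  obtain K where K: "(\<integral>\<^sup>+x\<in>{c..d}. 1 / f x \<partial>lborel) = ennreal K" "K \<ge> 0"
    using G by (cases "(\<integral>\<^sup>+x\<in>{c..d}. 1 / f x \<partial>lborel)") auto
  have [measurable]: "\<phi> \<in> borel_measurable borel" by (rule borel_measurable_continuous_onI[OF \<phi>])
  have "bounded (\<phi> ` {c..d})"
    by (intro compact_imp_bounded compact_continuous_image compact_Icc continuous_on_subset[OF \<phi>]) auto
  then have "\<exists>B. \<forall>x\<in>{c..d}. \<bar>\<phi> x\<bar> \<le> B" by (auto simp: bounded_iff)
  then obtain B where B: "\<And>x. x \<in> {c..d} \<Longrightarrow> \<bar>\<phi> x\<bar> \<le> B" by blast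
  have int: "integrable lborel (\<lambda>x. indicator {c..d} x * v x * \<phi> x)" 
    and le: "\<bar>LINT x|lborel. indicator {c..d} x * v x * \<phi> x\<bar>
        \<le> \<bar>B\<bar> * (L2_norm \<mu> v * sqrt K)" if v: "v \<in> L2 \<mu>" for v
  proof -
    note iv = L2_imp_L1_on_nondegenerate(1)[OF v cd K]
    have b: "\<bar>indicator {c..d} x * v x * \<phi> x\<bar> \<le> \<bar>B\<bar> * \<bar>indicator {c..d} x * v x\<bar>" for x
      using B[of x] by (auto simp: abs_mult mult.commute intro!: mult_right_mono split: split_indicator)
    show i: "integrable lborel (\<lambda>x. indicator {c..d} x * v x * \<phi> x)"
      by (rule Bochner_Integration.integrable_bound[OF integrable_mult_right[OF integrable_abs[OF iv], of
          "\<bar>B\<bar>"]])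
         (use b iv in \<open>auto simp: borel_measurable_integrable\<close>)
    have "\<bar>LINT x|lborel. indicator {c..d} x * v x * \<phi> x\<bar> \<le> (LINT x|lborel. \<bar>indicator {c..d} x * v x * \<phi>
        x\<bar>)"
      by (rule integral_abs_bound)
    also have "\<dots> \<le> (LINT x|lborel. \<bar>B\<bar> * \<bar>indicator {c..d} x * v x\<bar>)"
      by (intro integral_mono integrable_abs i integrable_mult_right iv b)
    also have "\<dots> \<le> \<bar>B\<bar> * (L2_norm \<mu> v * sqrt K)"
      using L2_imp_L1_on_nondegenerate(2)[OF v cd K] by (simp add: mult_left_mono)
    finally show "\<bar>LINT x|lborel. indicator {c..d} x * v x * \<phi> x\<bar> \<le> \<bar>B\<bar> * (L2_norm \<mu> v * sqrt K)" .
  qed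
  have uL: "u n \<in> L2 \<mu>" and wL: "w \<in> L2 \<mu>" for n using u by (auto simp: L2_tendsto_def)
  have "(\<lambda>n. (LINT x|lborel. indicator {c..d} x * u n x * \<phi> x)
      - (LINT x|lborel. indicator {c..d} x * w x * \<phi> x)) \<longlonglongrightarrow> 0"
  proof (rule Lim_null_comparison)
    have "(\<lambda>n. L2_norm \<mu> (\<lambda>x. u n x - w x)) \<longlonglongrightarrow> 0" using u by (simp add: L2_tendsto_def)
    then show "(\<lambda>n. \<bar>B\<bar> * (L2_norm \<mu> (\<lambda>x. u n x - w x) * sqrt K)) \<longlonglongrightarrow> 0"
      by (auto intro!: tendsto_eq_intros)
    show "\<forall>\<^sub>F n in sequentially. norm ((LINT x|lborel. indicator {c..d} x * u n x * \<phi> x)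
        - (LINT x|lborel. indicator {c..d} x * w x * \<phi> x))
       \<le> \<bar>B\<bar> * (L2_norm \<mu> (\<lambda>x. u n x - w x) * sqrt K)"
    proof (intro always_eventually allI)
      fix n
      have "(LINT x|lborel. indicator {c..d} x * u n x * \<phi> x)
          - (LINT x|lborel. indicator {c..d} x * w x * \<phi> x)
        = (LINT x|lborel. indicator {c..d} x * (u n x - w x) * \<phi> x)"
        by (subst Bochner_Integration.integral_diff[symmetric, OF int[OF uL] int[OF wL]])
           (simp add: left_diff_distrib right_diff_distrib)
      then show "norm ((LINT x|lborel. indicator {c..d} x * u n x * \<phi> x)
          - (LINT x|lborel. indicator {c..d} x * w x * \<phi> x))
       \<le> \<bar>B\<bar> * (L2_norm \<mu> (\<lambda>x. u n x - w x) * sqrt K)"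
        using le[OF L2_diff[OF uL wL], of n] by simp
    qed
  qed
  then show ?thesis by (simp add: LIM_zero_iff)
qed

text \<open>
  The distributional derivative of \<open>0\<close> is \<open>0\<close>. The test functions are \<open>(x - c) (d - x) q(x)\<close> with a
  polynomial \<open>q\<close>: the first two factors make them vanish at the ends, and they are positive inside, so
  that dividing them out again is harmless.
\<close>

lemma gradient_zero_AE_on_interval:
  assumes v: "v \<in> gradients I \<mu> (\<lambda>_. 0)" and cd: "a < c" "c < d" "d < b"
    and G: "(\<integral>\<^sup>+x\<in>{c..d}. 1 / f x \<partial>lborel) < \<infinity>"
  shows "AE x in lborel. x \<in> {c<..<d} \<longrightarrow> v x = 0"
proof -
  have sub: "{c..d} \<subseteq> I" using cd by (auto simp: I_eq)
  obtain K where K: "(\<integral>\<^sup>+x\<in>{c..d}. 1 / f x \<partial>lborel) = ennreal K" "K \<ge> 0"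
    using G by (cases "(\<integral>\<^sup>+x\<in>{c..d}. 1 / f x \<partial>lborel)") auto
  obtain u where u: "\<And>n. smooth_closure I (u n)" "L2_tendsto \<mu> u (\<lambda>_. 0)" "L2_tendsto \<mu> (\<lambda>n. deriv (u n)) v"
    using v by (auto simp: gradients_def)
  have vL: "v \<in> L2 \<mu>" using u by (simp add: L2_tendsto_def)
  define W where "W x = indicator {c..d} x * v x * ((x - c) * (d - x))" for x
  have "AE x in lborel. W x = 0"
  proof (rule AE_zero_if_integral_poly_zero[where c = c and d = d])
    show "integrable lborel W"
    proof (rule Bochner_Integration.integrable_bound[OF integrable_mult_right[OF
        L2_imp_L1_on_nondegenerate(1)[OF vL sub K], of "(d - c) * (d - c)"]])
      show "W \<in> borel_measurable lborel"
        unfolding W_def using borel_measurable_integrable[OF L2_imp_L1_on_nondegenerate(1)[OF vL sub K]]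
            by (rule borel_measurable_times) simp
      show "AE x in lborel. norm (W x) \<le> norm ((d - c) * (d - c) * (indicator {c..d} x * v x))"
        using cd by (intro AE_I2) (auto simp: W_def abs_mult mult.commute split: split_indicator
            intro!: mult_mono)
    qed
    show "W x = 0" if "x \<notin> {c..d}" for x using that by (simp add: W_def)
    fix q :: "real \<Rightarrow> real" assume q: "real_polynomial_function q"
    define \<phi> where "\<phi> x = (x - c) * (d - x) * q x" for x
    have "real_polynomial_function \<phi>"
      unfolding \<phi>_def by (intro real_polynomial_function.intros
          real_polynomial_function_diff q bounded_linear_ident)
    moreover obtain \<phi>' where \<phi>': "real_polynomial_function \<phi>'" "\<And>x. (\<phi> has_real_derivative \<phi>' x) (at x)"
      using has_real_derivative_polynomial_function[OF calculation] by blast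
    ultimately have cont: "continuous_on S \<phi>" "continuous_on S \<phi>'" for S
      by (simp_all add: continuous_on_polymonial_function real_polynomial_function_eq)
    have "(LINT x|lborel. indicator {c..d} x * deriv (u n) x * \<phi> x)
        = - (LINT x|lborel. indicator {c..d} x * u n x * \<phi>' x)" for n
      using integral_deriv_mult_test_function[of a b "u n" c d \<phi> \<phi>'] u(1)[of n] cd \<phi>' cont
          by (simp add: I_eq \<phi>_def)
    moreover have "(\<lambda>n. LINT x|lborel. indicator {c..d} x * deriv (u n) x * \<phi> x)
        \<longlonglongrightarrow> (LINT x|lborel. indicator {c..d} x * v x * \<phi> x)"
      by (rule L2_tendsto_weak[OF u(3) sub G cont(1)])
    moreover have "(\<lambda>n. - (LINT x|lborel. indicator {c..d} x * u n x * \<phi>' x))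
        \<longlonglongrightarrow> - (LINT x|lborel. indicator {c..d} x * 0 * \<phi>' x)"
      by (intro tendsto_minus L2_tendsto_weak[OF u(2) sub G cont(2)])
    ultimately have "(LINT x|lborel. indicator {c..d} x * v x * \<phi> x) = 0"
      using LIMSEQ_unique by fastforce
    then show "(LINT x|lborel. W x * q x) = 0"
      by (simp add: W_def \<phi>_def mult.assoc)
  qed
  then show ?thesis
    by eventually_elim (auto simp: W_def)
qed

text \<open>
  Rational end points make it possible to cover the complement of \<open>M\<close> by countably many intervals.
\<close>

lemma nondegenerate_interval:
  assumes "x \<in> I - M"
  shows "\<exists>c d. c \<in> \<rat> \<and> d \<in> \<rat> \<and> a < c \<and> c < x \<and> x < d \<and> d < b \<and> (\<integral>\<^sup>+x\<in>{c..d}. 1 / f x \<partial>lborel) < \<infinity>"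
proof -
  obtain e where e: "e > 0" "(\<integral>\<^sup>+t\<in>I \<inter> ball x e. 1 / f t \<partial>lborel) < \<infinity>"
    using assms by (auto simp: degenerate_set_def top.not_eq_extremum)
  obtain c where c: "c \<in> \<rat>" "max a (x - e) < c" "c < x"
    using Rats_dense_in_real[of "max a (x - e)" x] assms e by (auto simp: I_eq)
  obtain d where d: "d \<in> \<rat>" "x < d" "d < min b (x + e)"
    using Rats_dense_in_real[of x "min b (x + e)"] assms e by (auto simp: I_eq)
  have "(\<integral>\<^sup>+x\<in>{c..d}. 1 / f x \<partial>lborel) \<le> (\<integral>\<^sup>+t\<in>I \<inter> ball x e. 1 / f t \<partial>lborel)"
    using c d by (intro nn_integral_mono) (auto simp: I_eq dist_real_def split: split_indicator)
  then show ?thesis using c d e by (intro exI[of _ c] exI[of _ d]) auto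
qed

lemma M_sub: "M \<subseteq> I" by (auto simp: degenerate_set_def)

lemma M_borel [measurable]: "M \<in> sets borel"
proof -
  have "open (I - M)"
    unfolding open_dist
  proof safe
    fix x assume "x \<in> I" "x \<notin> M"
    then obtain c d where cd: "a < c" "c < x" "x < d" "d < b" "(\<integral>\<^sup>+x\<in>{c..d}. 1 / f x \<partial>lborel) < \<infinity>"
      using nondegenerate_interval[of x] by blast
    have "y \<in> I - M" if y: "y \<in> {c<..<d}" for y
    proof -
      define e where "e = min (y - c) (d - y)"
      have "(\<integral>\<^sup>+t\<in>I \<inter> ball y e. 1 / f t \<partial>lborel) \<le> (\<integral>\<^sup>+x\<in>{c..d}. 1 / f x \<partial>lborel)"
        by (intro nn_integral_mono) (auto simp: e_def dist_real_def split: split_indicator)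
      then have "(\<integral>\<^sup>+t\<in>I \<inter> ball y e. 1 / f t \<partial>lborel) \<noteq> \<infinity>" using cd by auto
      moreover have "e > 0" using y by (auto simp: e_def)
      ultimately show ?thesis using y cd by (auto simp: degenerate_set_def I_eq)
    qed
    moreover have "y \<in> {c<..<d}" if "dist y x < min (x - c) (d - x)" for y
      using that by (auto simp: dist_real_def abs_less_iff)
    ultimately have "\<forall>y. dist y x < min (x - c) (d - x) \<longrightarrow> y \<in> I - M"
      by blast
    then show "\<exists>e>0. \<forall>y. dist y x < e \<longrightarrow> y \<in> I - M"
      using cd by (intro exI[of _ "min (x - c) (d - x)"]) auto
  qed
  then have "I - (I - M) \<in> sets borel" by (intro sets.Diff I_borel borel_open)
  moreover have "I - (I - M) = M" using M_sub by auto
  ultimately show ?thesis by simp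
qed

lemma gradient_zero_AE:
  assumes v: "v \<in> gradients I \<mu> (\<lambda>_. 0)"
  shows "AE x in \<mu>. x \<notin> M \<union> A \<longrightarrow> v x = 0"
proof -
  have [measurable]: "v \<in> borel_measurable \<mu>"
    using v gradients_subset_L2 by (auto simp: L2_def)
  define v' where "v' x = indicator I x * v x" for x
  have v' [measurable]: "v' \<in> borel_measurable borel" unfolding v'_def
    by (rule measurable_\<mu>_indicator) simp
  \<comment> \<open>The interiors of these countably many rational intervals cover the complement of \<open>M\<close> in \<open>I\<close>.\<close>
  define R where "R = {(c, d). c \<in> \<rat> \<and> d \<in> \<rat> \<and> a < c \<and> c < d \<and> d < b \<and> (\<integral>\<^sup>+x\<in>{c..d}. 1 / f x \<partial>lborel) < \<infinity>}"
  have "countable R"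
    by (rule countable_subset[of _ "\<rat> \<times> \<rat>"]) (auto simp: R_def countable_rat)
  moreover have "AE x in lborel. x \<in> {fst r<..<snd r} \<longrightarrow> v x = 0" if "r \<in> R" for r
    using that v by (intro gradient_zero_AE_on_interval) (auto simp: R_def)
  ultimately have "AE x in lborel. \<forall>r\<in>R. x \<in> {fst r<..<snd r} \<longrightarrow> v x = 0"
    by (subst AE_ball_countable) auto
  then have ae: "AE x in lborel. x \<in> I - M \<longrightarrow> v x = 0"
  proof eventually_elim
    case (elim x)
    show ?case
    proof
      assume "x \<in> I - M"
      then obtain c d where "(c, d) \<in> R" "x \<in> {c<..<d}"
        using nondegenerate_interval[of x] by (force simp: R_def)
      then show "v x = 0" using elim by force
    qed
  qed
  define N where "N = {x. x \<in> I - (M \<union> A) \<and> v' x \<noteq> 0}"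
  have N [measurable]: "N \<in> sets borel" unfolding N_def by measurable
  have "emeasure \<mu> N = (\<integral>\<^sup>+x\<in>N. f x \<partial>lborel)"
    by (rule emeasure_off_A) (auto simp: N_def)
  also have "\<dots> = (\<integral>\<^sup>+(x::real). 0 \<partial>lborel)"
    by (rule nn_integral_cong_AE, rule AE_mp[OF ae]) (auto simp: N_def v'_def split: split_indicator)
  finally have N0: "emeasure \<mu> N = 0" by simp
  have "N \<in> sets \<mu>" unfolding sets_\<mu> sets_restrict_space
    using N by (intro image_eqI[of _ _ N]) (auto simp: N_def)
  with N0 have "AE x in \<mu>. x \<notin> N"
    by (subst AE_iff_measurable[of N]) (auto simp: space_\<mu> N_def)
  with AE_space show ?thesis
    by eventually_elim (auto simp: N_def v'_def space_\<mu>)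
qed

section \<open>The indicator of the degenerate part is a gradient of zero\<close>

text \<open>
  Take \<open>r = min(k, 1/f) / s\<close> where \<open>s\<close> is the integral of \<open>min(k, 1/f)\<close> over \<open>(c, d)\<close>. Since
  \<open>min(k, 1/f) \<cdot> f \<le> 1\<close>, the energy \<open>\<integral> r\<^sup>2 f dx\<close> is at most \<open>1/s\<close>. As \<open>k\<close> grows, \<open>s\<close> tends to the integral of
  \<open>1/f\<close>, which is infinite because \<open>(c, d)\<close> is a neighbourhood of a point of \<open>M\<close>. Setting \<open>r\<close> to \<open>0\<close> on \<open>A\<close>
  keeps the singular part of \<open>\<mu>\<close> from contributing.
\<close>

lemma low_energy_unit_mass:
  assumes x: "x \<in> M" "c < x" "x < d" and cd: "a \<le> c" "d \<le> b" and \<eta>: "\<eta> > 0"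
  shows "\<exists>r B. r \<in> borel_measurable borel \<and> (\<forall>y. 0 \<le> r y \<and> r y \<le> B) \<and> (\<forall>y. y \<notin> {c<..<d} - A \<longrightarrow> r y = 0)
     \<and> (\<integral>\<^sup>+y. ennreal (r y) \<partial>lborel) = 1 \<and> (\<integral>\<^sup>+y. ennreal ((r y)\<^sup>2) \<partial>\<mu>) \<le> ennreal \<eta>"
proof -
  define G :: "nat \<Rightarrow> real \<Rightarrow> ennreal" where "G k y = min (of_nat k) (1 / F y) * indicator {c<..<d} y" for k y
  have [measurable]: "G k \<in> borel_measurable borel" for k unfolding G_def by measurable
  have SUP_G: "(SUP k. G k y) = 1 / F y * indicator {c<..<d} y" for y
  proof -
    have "(SUP k. min (of_nat k) (1 / F y)) = (1 / F y)"
      using SUP_inf[of "\<lambda>k. of_nat k :: ennreal" UNIV "1 / F y"]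
      by (simp add: inf_min ennreal_SUP_of_nat_eq_top)
    then show ?thesis unfolding G_def by (subst SUP_mult_right_ennreal[symmetric]) simp
  qed
  have inc: "incseq G"
    by (intro incseq_SucI le_funI) (auto simp: G_def intro!: mult_right_mono min.mono)
  have "\<infinity> = (\<integral>\<^sup>+t\<in>I \<inter> ball x (min (x - c) (d - x)). 1 / f t \<partial>lborel)"
    using x by (auto simp: degenerate_set_def)
  also have "\<dots> \<le> (\<integral>\<^sup>+y. 1 / F y * indicator {c<..<d} y \<partial>lborel)"
    by (intro nn_integral_mono) (auto simp: F_def dist_real_def split: split_indicator)
  also have "\<dots> = (\<integral>\<^sup>+y. (SUP k. G k y) \<partial>lborel)" by (simp add: SUP_G)
  also have "\<dots> = (SUP k. \<integral>\<^sup>+y. G k y \<partial>lborel)"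
    by (rule nn_integral_monotone_convergence_SUP[OF inc]) simp
  finally have "(SUP k. \<integral>\<^sup>+y. G k y \<partial>lborel) = \<infinity>" by (simp add: top_unique)
  then have "ennreal (1 / \<eta>) < (SUP k. \<integral>\<^sup>+y. G k y \<partial>lborel)"
    by (simp only:) simp
  then obtain k where k: "ennreal (1 / \<eta>) < (\<integral>\<^sup>+y. G k y \<partial>lborel)" by (auto simp: less_SUP_iff)
  have Gk: "G k y \<le> ennreal (real k)" for y
    by (auto simp: G_def ennreal_of_nat_eq_real_of_nat split: split_indicator)
  have "(\<integral>\<^sup>+y. G k y \<partial>lborel) \<le> (\<integral>\<^sup>+y. ennreal (real k) * indicator {c<..<d} y \<partial>lborel)"
    by (intro nn_integral_mono) (auto simp: G_def ennreal_of_nat_eq_real_of_nat split: split_indicator)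
  also have "\<dots> = ennreal (real k * (d - c))"
    using x by (simp add: nn_integral_cmult ennreal_mult)
  finally obtain s where s: "(\<integral>\<^sup>+y. G k y \<partial>lborel) = ennreal s" "s \<ge> 0"
    by (cases "\<integral>\<^sup>+y. G k y \<partial>lborel") (auto simp: top_unique)
  have s1: "1 / \<eta> < s" using k s \<eta> by (simp add: ennreal_less_iff)
  moreover have "0 < 1 / \<eta>" using \<eta> by simp
  ultimately have s0: "s > 0" by linarith
  define r where "r y = enn2real (G k y) / s * indicator (- A) y" for y
  have Gr: "ennreal (enn2real (G k y)) = G k y" for y
    using Gk[of y] by (intro ennreal_enn2real) (auto intro: order_le_less_trans)
  have Gr': "enn2real (G k y) \<le> real k" for y
    using Gk[of y] Gr[of y] by (metis ennreal_le_iff of_nat_0_le_iff)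
  have [measurable]: "r \<in> borel_measurable borel" unfolding r_def by measurable
  have r0: "0 \<le> r y" "r y \<le> real k / s" for y
    using s0 Gr'[of y] by (auto simp: r_def divide_right_mono split: split_indicator)
  have supp: "r y = 0" if "y \<notin> {c<..<d} - A" for y
    using that by (auto simp: r_def G_def split: split_indicator)
  have er: "ennreal (r y) = G k y * ennreal (1 / s)" if "y \<notin> A" for y
  proof -
    have "ennreal (r y) = ennreal (enn2real (G k y) * (1 / s))" using that by (simp add: r_def)
    also have "\<dots> = ennreal (enn2real (G k y)) * ennreal (1 / s)"
      using s0 by (intro ennreal_mult) auto
    finally show ?thesis by (simp only: Gr)
  qed
  have int: "(\<integral>\<^sup>+y. ennreal (r y) \<partial>lborel) = 1"
  proof -
    have "(\<integral>\<^sup>+y. ennreal (r y) \<partial>lborel) = (\<integral>\<^sup>+y. G k y * ennreal (1 / s) \<partial>lborel)"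
      by (rule nn_integral_cong_AE, rule AE_mp[OF AE_off_A]) (simp add: er)
    also have "\<dots> = ennreal s * ennreal (1 / s)" by (subst nn_integral_multc) (auto simp: s)
    also have "\<dots> = 1" using s0 by (simp add: ennreal_mult[symmetric])
    finally show ?thesis .
  qed
  have en: "(\<integral>\<^sup>+y. ennreal ((r y)\<^sup>2) \<partial>\<mu>) \<le> ennreal \<eta>"
  proof -
    have "(\<integral>\<^sup>+y. ennreal ((r y)\<^sup>2) \<partial>\<mu>) = (\<integral>\<^sup>+y. ennreal ((r y)\<^sup>2) * indicator (- A) y \<partial>\<mu>)"
      by (intro nn_integral_cong) (auto simp: supp split: split_indicator)
    also have "\<dots> = (\<integral>\<^sup>+y. ennreal ((r y)\<^sup>2) * F y \<partial>lborel)"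
      by (rule nn_integral_off_A) simp
    also have "\<dots> \<le> (\<integral>\<^sup>+y. G k y * ennreal (1 / s\<^sup>2) \<partial>lborel)"
    proof (intro nn_integral_mono)
      fix y
      show "ennreal ((r y)\<^sup>2) * F y \<le> G k y * ennreal (1 / s\<^sup>2)"
      proof (cases "y \<in> A")
        case True
        then show ?thesis by (simp add: supp)
      next
        case False
        have "G k y * F y \<le> 1 / F y * F y"
          by (intro mult_right_mono) (auto simp: G_def split: split_indicator)
        also have "\<dots> \<le> 1"
        proof (cases "F y = 0 \<or> F y = top")
          case True
          then show ?thesis by auto
        next
          case False
          then have "F y * (1 / F y) = 1"
            by (simp add: ennreal_times_divide top.not_eq_extremum ennreal_divide_self)
          then show ?thesis by (simp add: mult.commute)
        qed
        finally have GF: "G k y * F y \<le> 1" .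
        have "ennreal ((r y)\<^sup>2) * F y = (G k y * ennreal (1 / s\<^sup>2)) * (G k y * F y)"
        proof -
          have "ennreal ((r y)\<^sup>2) = (G k y * ennreal (1 / s))\<^sup>2"
            unfolding er[OF False, symmetric] using r0(1)[of y] by (simp add: ennreal_power)
          also have "\<dots> = (G k y * G k y) * ennreal (1 / s\<^sup>2)"
          proof -
            have "ennreal (1 / s\<^sup>2) = ennreal (1 / s) * ennreal (1 / s)"
              using s0 by (simp add: ennreal_mult[symmetric] power2_eq_square)
            then show ?thesis by (simp only: power2_eq_square mult_ac)
          qed
          finally show ?thesis by (simp only: mult_ac)
        qed
        also have "\<dots> \<le> (G k y * ennreal (1 / s\<^sup>2)) * 1"
          using GF by (intro mult_left_mono) auto
        finally show ?thesis by simp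
      qed
    qed
    also have "\<dots> = ennreal s * ennreal (1 / s\<^sup>2)"
      by (subst nn_integral_multc) (auto simp: s)
    also have "\<dots> = ennreal (1 / s)" using s0 by (simp add: ennreal_mult[symmetric] power2_eq_square)
    also have "\<dots> \<le> ennreal \<eta>"
      using s1 s0 \<eta> by (intro ennreal_leI) (simp add: field_simps)
    finally show ?thesis .
  qed
  show ?thesis
    using r0 supp int en by (intro exI[of _ r] exI[of _ "real k / s"]) auto
qed

text \<open>
  The multiple of the preceding function that carries exactly the Lebesgue measure of \<open>M\<close> in the cell.
  A cell without points of \<open>M\<close> has nothing to cancel.
\<close>

lemma low_energy_cell_mass:
  assumes cd: "a \<le> c" "c < d" "d \<le> b" and \<eta>: "\<eta> > 0"
  shows "\<exists>r B. r \<in> borel_measurable borel \<and> (\<forall>y. 0 \<le> r y \<and> r y \<le> B) \<and> (\<forall>y. y \<notin> {c<..<d} - A \<longrightarrow> r y = 0)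
     \<and> integrable lborel r \<and> (LINT y|lborel. r y) = measure lborel (M \<inter> {c<..<d})
         \<and> (\<integral>\<^sup>+y. ennreal ((r y)\<^sup>2) \<partial>\<mu>) \<le> ennreal \<eta>"
proof (cases "M \<inter> {c<..<d} = {}")
  case True
  then show ?thesis by (intro exI[of _ "\<lambda>_. 0"] exI[of _ 0]) auto
next
  case False
  define m where "m = measure lborel (M \<inter> {c<..<d})"
  have m0: "m \<ge> 0" by (simp add: m_def)
  obtain x where x: "x \<in> M" "c < x" "x < d" using False by auto
  \<comment> \<open>Scaling by \<open>m\<close> multiplies the energy by \<open>m\<^sup>2\<close>; the summand \<open>1\<close> covers the case \<open>m = 0\<close>.\<close>
  have e: "\<eta> / (m\<^sup>2 + 1) > 0" using \<eta> by (simp add: add_nonneg_pos)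
  obtain r B where r: "r \<in> borel_measurable borel" "\<And>y. 0 \<le> r y" "\<And>y. r y \<le> B"
      "\<And>y. y \<notin> {c<..<d} - A \<Longrightarrow> r y = 0" "(\<integral>\<^sup>+y. ennreal (r y) \<partial>lborel) = 1"
      "(\<integral>\<^sup>+y. ennreal ((r y)\<^sup>2) \<partial>\<mu>) \<le> ennreal (\<eta> / (m\<^sup>2 + 1))"
    using low_energy_unit_mass[OF x cd(1,3) e] by blast
  note [measurable] = r(1)
  have ir: "integrable lborel r"
    using r by (intro integrableI_bounded) auto
  have "ennreal (LINT y|lborel. r y) = 1"
    using nn_integral_eq_integral[OF ir] r by simp
  then have ir1: "(LINT y|lborel. r y) = 1" by (simp add: ennreal_eq_1)
  have rm: "r \<in> borel_measurable \<mu>" by (rule measurable_\<mu>[OF r(1)])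
  have "(\<integral>\<^sup>+y. ennreal ((m * r y)\<^sup>2) \<partial>\<mu>) = (\<integral>\<^sup>+y. ennreal (m\<^sup>2) * ennreal ((r y)\<^sup>2) \<partial>\<mu>)"
    by (simp add: power_mult_distrib ennreal_mult)
  also have "\<dots> = ennreal (m\<^sup>2) * (\<integral>\<^sup>+y. ennreal ((r y)\<^sup>2) \<partial>\<mu>)"
    using rm by (intro nn_integral_cmult) auto
  also have "\<dots> \<le> ennreal (m\<^sup>2) * ennreal (\<eta> / (m\<^sup>2 + 1))"
    using r by (intro mult_left_mono) auto
  also have "\<dots> = ennreal (m\<^sup>2 * (\<eta> / (m\<^sup>2 + 1)))" using e by (intro ennreal_mult[symmetric]) auto
  also have "\<dots> \<le> ennreal \<eta>"
  proof (intro ennreal_leI)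
    have p: "m\<^sup>2 + 1 > 0" by (simp add: add_nonneg_pos)
    have "m\<^sup>2 * \<eta> \<le> \<eta> * (m\<^sup>2 + 1)" using \<eta> by (simp add: algebra_simps)
    then show "m\<^sup>2 * (\<eta> / (m\<^sup>2 + 1)) \<le> \<eta>" using p by (simp add: pos_divide_le_eq)
  qed
  finally have "(\<integral>\<^sup>+y. ennreal ((m * r y)\<^sup>2) \<partial>\<mu>) \<le> ennreal \<eta>" .
  then show ?thesis
    using r ir ir1 m0 by (intro exI[of _ "\<lambda>y. m * r y"] exI[of _ "m * B"]) (auto
        simp: m_def[symmetric] mult_left_mono)
qed

lemma integrable_indicator_bounded:
  fixes h :: "real \<Rightarrow> real"
  assumes "h \<in> borel_measurable borel" "\<And>y. \<bar>h y\<bar> \<le> B"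
  shows "integrable lborel (\<lambda>y. h y * indicator {c<..d} y)"
proof (rule Bochner_Integration.integrable_bound)
  show "integrable lborel (\<lambda>y. B * indicator {c<..d} y :: real)"
    by (intro integrable_mult_right integrable_real_indicator emeasure_bounded_finite bounded_Ioc) auto
  show "AE y in lborel. norm (h y * indicator {c<..d} y) \<le> norm (B * indicator {c<..d} y)"
    using assms(2) by (auto intro!: AE_I2 order_trans[OF assms(2) abs_ge_self] split: split_indicator)
qed (use assms(1) in simp)

text \<open>
  Induction over the cells \<open>(a + i \<delta>, a + (i + 1) \<delta>)\<close>. The primitive of \<open>1\<^bsub>M\<^esub> - R\<close> is \<open>0\<close> at the start of
  the new cell, and within it both \<open>M\<close> and the correction contribute an amount between \<open>0\<close> and \<open>\<delta>\<close>, so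
  their difference is at most \<open>\<delta>\<close>; at the end of the cell the two amounts agree. The corrections of
  different cells have disjoint supports, so their energies add up.
\<close>

lemma balanced_correction:
  assumes \<delta>: "\<delta> > 0" and \<eta>: "\<eta> > 0" and n: "a + real n * \<delta> \<le> b"
  shows "\<exists>R B. R \<in> borel_measurable borel \<and> (\<forall>y. 0 \<le> R y \<and> R y \<le> B) \<and> (\<forall>y. y \<notin> {a<..<a + real n * \<delta>} - A
      \<longrightarrow> R y = 0)
     \<and> (\<integral>\<^sup>+y. ennreal ((R y)\<^sup>2) \<partial>\<mu>) \<le> ennreal (real n * \<eta>)
     \<and> (LINT y|lborel. (indicator M y - R y) * indicator {a<..a + real n * \<delta>} y) = 0
     \<and> (\<forall>x\<in>{a..a + real n * \<delta>}. \<bar>LINT y|lborel. (indicator M y - R y) * indicator {a<..x} y\<bar> \<le> \<delta>)"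
  using n
proof (induction n)
  case 0
  show ?case using \<delta> by (intro exI[of _ "\<lambda>_. 0"] exI[of _ 0]) auto
next
  case (Suc n)
  define T where "T = a + real n * \<delta>"
  define T' where "T' = a + real (Suc n) * \<delta>"
  have TT: "T' = T + \<delta>" "a \<le> T" "T < T'" "T' \<le> b" "T \<le> b"
    using \<delta> Suc.prems by (auto simp: T_def T'_def algebra_simps)
  obtain R B where R: "R \<in> borel_measurable borel" "\<And>y. 0 \<le> R y" "\<And>y. R y \<le> B"
      "\<And>y. y \<notin> {a<..<T} - A \<Longrightarrow> R y = 0"
      "(\<integral>\<^sup>+y. ennreal ((R y)\<^sup>2) \<partial>\<mu>) \<le> ennreal (real n * \<eta>)"
      "(LINT y|lborel. (indicator M y - R y) * indicator {a<..T} y) = 0"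
      "\<And>x. x \<in> {a..T} \<Longrightarrow> \<bar>LINT y|lborel. (indicator M y - R y) * indicator {a<..x} y\<bar> \<le> \<delta>"
    using Suc.IH TT(5) unfolding T_def[symmetric] by blast
  obtain r C where r: "r \<in> borel_measurable borel" "\<And>y. 0 \<le> r y" "\<And>y. r y \<le> C"
      "\<And>y. y \<notin> {T<..<T'} - A \<Longrightarrow> r y = 0"
      "integrable lborel r" "(LINT y|lborel. r y) = measure lborel (M \<inter> {T<..<T'})"
      "(\<integral>\<^sup>+y. ennreal ((r y)\<^sup>2) \<partial>\<mu>) \<le> ennreal \<eta>"
    using low_energy_cell_mass[OF TT(2,3,4) \<eta>] by blast
  note [measurable] = R(1) r(1)
  define R' where "R' y = R y + r y" for y
  have R'_left: "R' y = R y" if "y \<le> T" for y using r(4)[of y] that by (auto simp: R'_def)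
  have R'_right: "R' y = r y" if "y > T" for y using R(4)[of y] that by (auto simp: R'_def)
  have sq: "(R' y)\<^sup>2 = (R y)\<^sup>2 + (r y)\<^sup>2" for y
    using R(4)[of y] r(4)[of y] by (cases "y \<le> T") (auto simp: R'_def)
  have m: "R \<in> borel_measurable \<mu>" "r \<in> borel_measurable \<mu>" using R(1) r(1) by (auto intro: measurable_\<mu>)
  have "(\<integral>\<^sup>+y. ennreal ((R' y)\<^sup>2) \<partial>\<mu>) = (\<integral>\<^sup>+y. ennreal ((R y)\<^sup>2) \<partial>\<mu>) + (\<integral>\<^sup>+y. ennreal ((r y)\<^sup>2) \<partial>\<mu>)"
    using m by (simp add: sq ennreal_plus nn_integral_add)
  also have "\<dots> \<le> ennreal (real n * \<eta>) + ennreal \<eta>" using R(5) r(7) by (rule add_mono)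
  also have "\<dots> = ennreal (real (Suc n) * \<eta>)"
    using \<eta> by (simp add: ennreal_plus[symmetric] algebra_simps del: ennreal_plus)
  finally have energy: "(\<integral>\<^sup>+y. ennreal ((R' y)\<^sup>2) \<partial>\<mu>) \<le> ennreal (real (Suc n) * \<eta>)" .
  have bd1: "\<bar>indicator M y - R y\<bar> \<le> 1 + B" and bd2: "\<bar>indicator M y - r y\<bar> \<le> 1 + C"
    and bdM: "\<bar>indicator M y :: real\<bar> \<le> 1" and bdr: "\<bar>r y\<bar> \<le> C" for y
    using R(2,3)[of y] r(2,3)[of y] by (auto split: split_indicator)
  have split: "(LINT y|lborel. (indicator M y - R' y) * indicator {a<..x} y)
      = (LINT y|lborel. (indicator M y - r y) * indicator {T<..x} y)"
    if "T \<le> x" for x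
  proof -
    have "(LINT y|lborel. (indicator M y - R' y) * indicator {a<..x} y)
       = (LINT y|lborel. (indicator M y - R y) * indicator {a<..T} y + (indicator M y - r y) * indicator
           {T<..x} y)"
    proof (intro Bochner_Integration.integral_cong refl)
      fix y
      show "(indicator M y - R' y) * indicator {a<..x} y
        = (indicator M y - R y) * indicator {a<..T} y + (indicator M y - r y) * indicator {T<..x} y"
        using that TT R'_left[of y] R'_right[of y] by (cases "y \<le> T") (auto split: split_indicator)
    qed
    also have "\<dots> = (LINT y|lborel. (indicator M y - R y) * indicator {a<..T} y)
        + (LINT y|lborel. (indicator M y - r y) * indicator {T<..x} y)"
      by (intro Bochner_Integration.integral_add integrable_indicator_bounded[OF _ bd1]
          integrable_indicator_bounded[OF _ bd2]) auto
    finally show ?thesis by (simp add: R(6))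
  qed
  have diff: "(LINT y|lborel. (indicator M y - r y) * indicator {T<..x} y)
     = measure lborel (M \<inter> {T<..x}) - (LINT y|lborel. r y * indicator {T<..x} y)" for x
  proof -
    have "(LINT y|lborel. (indicator M y - r y) * indicator {T<..x} y)
       = (LINT y|lborel. indicator M y * indicator {T<..x} y) - (LINT y|lborel. r y * indicator {T<..x} y)"
      unfolding left_diff_distrib
      by (intro Bochner_Integration.integral_diff integrable_indicator_bounded[OF _ bdM]
          integrable_indicator_bounded[OF _ bdr]) auto
    also have "(LINT y|lborel. indicator M y * indicator {T<..x} y) = measure lborel (M \<inter> {T<..x})"
      by (simp add: indicator_inter_arith[symmetric])
    finally show ?thesis .
  qed
  have "\<bar>LINT y|lborel. (indicator M y - R' y) * indicator {a<..x} y\<bar> \<le> \<delta>" if x: "x \<in> {a..T'}" for x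
  proof (cases "x \<le> T")
    case True
    have "(LINT y|lborel. (indicator M y - R' y) * indicator {a<..x} y)
        = (LINT y|lborel. (indicator M y - R y) * indicator {a<..x} y)"
      using R'_left True by (intro Bochner_Integration.integral_cong refl) (auto split: split_indicator)
    then show ?thesis using R(7)[of x] x True by auto
  next
    case False
    have 1: "measure lborel (M \<inter> {T<..x}) \<le> \<delta>"
    proof -
      have "measure lborel (M \<inter> {T<..x}) \<le> measure lborel {T..x}"
        using False by (intro measure_mono_fmeasurable fmeasurableI) auto
      also have "\<dots> \<le> \<delta>" using x False TT by auto
      finally show ?thesis .
    qed
    have 2: "0 \<le> (LINT y|lborel. r y * indicator {T<..x} y)"
      using r(2) by (intro integral_nonneg_AE) auto
    have "(LINT y|lborel. r y * indicator {T<..x} y) \<le> (LINT y|lborel. r y)"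
      using r(2) by (intro integral_mono integrable_indicator_bounded[OF _ bdr] r(5)) (auto
          split: split_indicator)
    also have "\<dots> \<le> measure lborel {T..T'}"
      unfolding r(6) using TT by (intro measure_mono_fmeasurable fmeasurableI) auto
    also have "\<dots> = \<delta>" using TT by simp
    finally have 3: "(LINT y|lborel. r y * indicator {T<..x} y) \<le> \<delta>" .
    have 4: "0 \<le> measure lborel (M \<inter> {T<..x})" by simp
    show ?thesis using split[of x] diff[of x] 1 2 3 4 False by linarith
  qed
  moreover have "(LINT y|lborel. (indicator M y - R' y) * indicator {a<..T'} y) = 0"
  proof -
    have "(LINT y|lborel. r y * indicator {T<..T'} y) = (LINT y|lborel. r y)"
    proof (intro Bochner_Integration.integral_cong refl)
      fix y show "r y * indicator {T<..T'} y = r y" using r(4)[of y] by (auto split: split_indicator)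
    qed
    moreover have "measure lborel (M \<inter> {T<..T'}) = measure lborel (M \<inter> {T<..<T'})"
    proof (rule measure_eq_AE)
      have "AE y in lborel. y \<noteq> T'" by (rule AE_lborel_singleton)
      then show "AE y in lborel. (y \<in> M \<inter> {T<..T'}) = (y \<in> M \<inter> {T<..<T'})" by eventually_elim auto
    qed auto
    ultimately show ?thesis using split[of T'] diff[of T'] r(6) TT by simp
  qed
  moreover have "R' \<in> borel_measurable borel" unfolding R'_def by measurable
  moreover have "0 \<le> R' y \<and> R' y \<le> B + C" for y
    using R(2,3)[of y] r(2,3)[of y] by (simp add: R'_def)
  moreover have "R' y = 0" if "y \<notin> {a<..<T'} - A" for y
    using that R(4)[of y] r(4)[of y] TT by (auto simp: R'_def)
  ultimately show ?case
    using energy unfolding T'_def[symmetric] by (intro exI[of _ R'] exI[of _ "B + C"]) blast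
qed

text \<open>
  Three errors have to be balanced: the number of cells controls the primitive of \<open>g\<close>, the energy per
  cell controls the distance of \<open>g\<close> from the indicator, and the quality \<open>e'\<close> of the polynomial
  approximation affects both. With total mass \<open>C\<close>, a primitive bounded by \<open>2 s\<close> has squared norm at most
  \<open>(2 s)\<^sup>2 C\<close>, which dictates the value of \<open>s\<close>.
\<close>

lemma indicator_approx_by_derivatives:
  assumes e: "e > 0"
  shows "\<exists>u p. real_polynomial_function u \<and> real_polynomial_function p
      \<and> (\<forall>x. (u has_real_derivative p x) (at x))
     \<and> (\<integral>\<^sup>+x. ennreal ((u x)\<^sup>2) \<partial>\<mu>) \<le> ennreal e
     \<and> (\<integral>\<^sup>+x. ennreal ((p x - indicator (M \<union> A) x)\<^sup>2) \<partial>\<mu>) \<le> ennreal e"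
proof -
  define C where "C = measure \<mu> I"
  have C: "emeasure \<mu> I = ennreal C" "C \<ge> 0"
    using finite_measure.emeasure_eq_measure[OF fin, of I] by (auto simp: C_def)
  define s where "s = sqrt (e / (C + 1)) / 2"
  have s: "s > 0" and s2: "(2 * s)\<^sup>2 = e / (C + 1)" using e C by (auto simp: s_def)
  obtain N where N: "(b - a) / s < real N" using reals_Archimedean2 by blast
  have N0: "real N > 0" using N ab s by (meson diff_gt_0_iff_gt divide_pos_pos order_less_trans)
  define \<delta> where "\<delta> = (b - a) / real N"
  have \<delta>: "\<delta> > 0" "\<delta> < s" "a + real N * \<delta> = b"
    using N N0 ab s by (auto simp: \<delta>_def field_simps)
  define \<eta> where "\<eta> = e / (8 * real N)"
  have \<eta>: "\<eta> > 0" "real N * \<eta> = e / 8" using e N0 by (auto simp: \<eta>_def)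
  have "a + real N * \<delta> \<le> b" using \<delta> by simp
  from balanced_correction[OF \<delta>(1) \<eta>(1) this]
  obtain R B where R: "R \<in> borel_measurable borel" "\<And>y. 0 \<le> R y" "\<And>y. R y \<le> B"
      "\<And>y. y \<notin> {a<..<b} - A \<Longrightarrow> R y = 0"
      "(\<integral>\<^sup>+y. ennreal ((R y)\<^sup>2) \<partial>\<mu>) \<le> ennreal (e / 8)"
      "\<And>x. x \<in> {a..b} \<Longrightarrow> \<bar>LINT y|lborel. (indicator M y - R y) * indicator {a<..x} y\<bar> \<le> \<delta>"
    unfolding \<delta>(3) \<eta>(2) by blast
  note [measurable] = R(1)
  define g where "g y = indicator (M \<union> A) y - R y" for y
  have gm [measurable]: "g \<in> borel_measurable borel" unfolding g_def by measurable
  have g_bdd: "\<bar>g y\<bar> \<le> 1 + B" for y using R(2,3)[of y] by (auto simp: g_def split: split_indicator)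
  define L where "L = density lborel (indicator {a..b} :: real \<Rightarrow> ennreal)"
  have sL: "sets L = sets borel" by (simp add: L_def)
  have nn_L: "(\<integral>\<^sup>+x. h x \<partial>L) = (\<integral>\<^sup>+x. indicator {a..b} x * h x \<partial>lborel)" if "h \<in> borel_measurable borel" for h
    unfolding L_def using that by (subst nn_integral_density) auto
  have L1: "(\<integral>\<^sup>+x. 1 \<partial>L) = ennreal (b - a)" using ab by (subst nn_L) auto
  have fL: "finite_measure L"
    by (rule finite_measureI) (use L1 in \<open>simp\<close>)
  have cL: "emeasure L (- {a..b}) = 0"
    by (simp add: L_def emeasure_density indicator_inter_arith[symmetric])
  \<comment> \<open>The first bound serves the gradient; by Cauchy-Schwarz on \<open>[a, b]\<close> the second one keeps the
      primitives within \<open>s\<close>.\<close>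
  define e' where "e' = min (e / 4) (s\<^sup>2 / (b - a))"
  have e': "e' > 0" "e' \<le> e / 4" "e' * (b - a) \<le> s\<^sup>2"
  proof -
    show "e' > 0" using e s ab by (simp add: e'_def)
    have "e' \<le> s\<^sup>2 / (b - a)" by (simp add: e'_def)
    then show "e' * (b - a) \<le> s\<^sup>2" using ab by (simp add: pos_le_divide_eq)
    show "e' \<le> e / 4" unfolding e'_def by (rule min.cobounded1)
  qed
  obtain p where p: "real_polynomial_function p" "(\<integral>\<^sup>+x. ennreal ((g x - p x)\<^sup>2) \<partial>\<mu>R) < ennreal e'"
      "(\<integral>\<^sup>+x. ennreal ((g x - p x)\<^sup>2) \<partial>L) < ennreal e'"
    using finite_borel_poly_dense_pair[OF finite_\<mu>R sets_\<mu>R conc_\<mu>R fL sL cL gm g_bdd e'(1)] by blast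
  note [measurable] = real_polynomial_function_measurable[OF p(1)]
  obtain u where u: "real_polynomial_function u" "\<And>x. (u has_real_derivative p x) (at x)" "u a = 0"
    using real_polynomial_function_antiderivative[OF p(1), of a] by blast
  have contp: "continuous_on S p" for S
    using p(1) by (simp add: continuous_on_polymonial_function real_polynomial_function_eq)
  have intp: "integrable lborel (\<lambda>y. indicator {c..d} y * p y)" for c d
    using borel_integrable_compact[OF compact_Icc contp, of c d] by simp
  have dist_L1: "(LINT y|lborel. indicator {a..b} y * \<bar>g y - p y\<bar>) \<le> s"
  proof -
    have "(\<integral>\<^sup>+y. ennreal \<bar>g y - p y\<bar> * 1 \<partial>L)\<^sup>2 \<le> (\<integral>\<^sup>+y. (ennreal \<bar>g y - p y\<bar>)\<^sup>2 \<partial>L) * (\<integral>\<^sup>+y. 1\<^sup>2 \<partial>L)"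
      by (rule Cauchy_Schwarz_nn_integral) (simp_all add: measurable_cong_sets[OF sL refl])
    also have "\<dots> = (\<integral>\<^sup>+y. ennreal ((g y - p y)\<^sup>2) \<partial>L) * ennreal (b - a)"
      using L1 by (simp add: ennreal_power)
    also have "\<dots> \<le> ennreal e' * ennreal (b - a)" using p(3) by (intro mult_right_mono) auto
    also have "\<dots> \<le> ennreal (s\<^sup>2)" using e' ab by (simp add: ennreal_mult[symmetric] ennreal_leI)
    finally have "(\<integral>\<^sup>+y. ennreal \<bar>g y - p y\<bar> \<partial>L)\<^sup>2 \<le> ennreal (s\<^sup>2)" by simp
    then have "(\<integral>\<^sup>+y. ennreal \<bar>g y - p y\<bar> \<partial>L) \<le> ennreal s"
      using s by (cases "\<integral>\<^sup>+y. ennreal \<bar>g y - p y\<bar> \<partial>L")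
        (auto simp: ennreal_power ennreal_le_iff power_mono_iff top_power_ennreal top_unique)
    moreover have "(\<integral>\<^sup>+y. ennreal \<bar>g y - p y\<bar> \<partial>L)
        = (\<integral>\<^sup>+y. ennreal (indicator {a..b} y * \<bar>g y - p y\<bar>) \<partial>lborel)"
      by (subst nn_L) (auto intro!: nn_integral_cong split: split_indicator)
    ultimately have "enn2real (\<integral>\<^sup>+y. ennreal (indicator {a..b} y * \<bar>g y - p y\<bar>) \<partial>lborel) \<le> s"
      using s by (intro enn2real_leI) auto
    then show ?thesis by (subst integral_eq_nn_integral) auto
  qed
  have u_bdd: "\<bar>u x\<bar> \<le> 2 * s" if x: "x \<in> I" for x
  proof -
    have x': "a \<le> x" "x \<le> b" using x by (auto simp: I_eq)
    have "u x = (LINT y|lborel. indicator {a..x} y *\<^sub>R p y)"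
      using integral_FTC_Icc[OF x'(1), of u p] u contp
      by (simp add: has_real_derivative_iff_has_vector_derivative has_vector_derivative_at_within)
    also have "\<dots> = (LINT y|lborel. p y * indicator {a<..x} y)"
    proof (rule integral_cong_AE)
      have "AE y in lborel. y \<noteq> a" by (rule AE_lborel_singleton)
      then show "AE y in lborel. indicator {a..x} y *\<^sub>R p y = p y * indicator {a<..x} y"
        by eventually_elim (auto split: split_indicator)
    qed auto
    finally have ux: "u x = (LINT y|lborel. p y * indicator {a<..x} y)" .
    have ip: "integrable lborel (\<lambda>y. p y * indicator {a<..x} y)"
      by (rule Bochner_Integration.integrable_bound[OF intp[of a x]]) (auto intro!: AE_I2
          split: split_indicator)
    have ig: "integrable lborel (\<lambda>y. g y * indicator {a<..x} y)"
      by (rule integrable_indicator_bounded[OF _ g_bdd]) simp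
    have igp: "integrable lborel (\<lambda>y. indicator {a..b} y * \<bar>g y - p y\<bar>)"
    proof (rule Bochner_Integration.integrable_bound)
      show "integrable lborel (\<lambda>y. \<bar>indicator {a..b} y * (1 + B)\<bar> + \<bar>indicator {a..b} y * p y\<bar>)"
        by (intro Bochner_Integration.integrable_add integrable_abs intp integrable_mult_left
            integrable_real_indicator emeasure_bounded_finite bounded_closed_interval) auto
      show "AE y in lborel. norm (indicator {a..b} y * \<bar>g y - p y\<bar>)
          \<le> norm (\<bar>indicator {a..b} y * (1 + B)\<bar> + \<bar>indicator {a..b} y * p y\<bar>)"
      proof (intro AE_I2)
        fix y show "norm (indicator {a..b} y * \<bar>g y - p y\<bar>)
            \<le> norm (\<bar>indicator {a..b} y * (1 + B)\<bar> + \<bar>indicator {a..b} y * p y\<bar>)"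
          using g_bdd[of y] by (auto split: split_indicator)
      qed
    qed simp
    \<comment> \<open>Lebesgue integrals do not see the part of the indicator on \<open>A\<close>.\<close>
    have "(LINT y|lborel. g y * indicator {a<..x} y)
        = (LINT y|lborel. (indicator M y - R y) * indicator {a<..x} y)"
      by (rule integral_cong_AE, simp, simp, rule AE_mp[OF AE_off_A])
         (auto simp: g_def intro!: AE_I2 split: split_indicator)
    then have G: "\<bar>LINT y|lborel. g y * indicator {a<..x} y\<bar> \<le> \<delta>" using R(6)[of x] x' by simp
    have "\<bar>u x - (LINT y|lborel. g y * indicator {a<..x} y)\<bar>
        = \<bar>LINT y|lborel. p y * indicator {a<..x} y - g y * indicator {a<..x} y\<bar>"
      unfolding ux using ip ig by (subst Bochner_Integration.integral_diff) auto
    also have "\<dots> \<le> (LINT y|lborel. \<bar>p y * indicator {a<..x} y - g y * indicator {a<..x} y\<bar>)"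
      by (rule integral_abs_bound)
    also have "\<dots> \<le> (LINT y|lborel. indicator {a..b} y * \<bar>g y - p y\<bar>)"
      using x' by (intro integral_mono integrable_abs Bochner_Integration.integrable_diff ip ig igp)
        (auto split: split_indicator)
    also have "\<dots> \<le> s" by (rule dist_L1)
    finally show ?thesis using G \<delta>(2) by linarith
  qed
  have "(\<integral>\<^sup>+x. ennreal ((u x)\<^sup>2) \<partial>\<mu>) \<le> (\<integral>\<^sup>+x. ennreal ((2 * s)\<^sup>2) \<partial>\<mu>)"
  proof (intro nn_integral_mono ennreal_leI)
    fix x assume "x \<in> space \<mu>"
    then have "\<bar>u x\<bar> \<le> \<bar>2 * s\<bar>" using u_bdd[of x] s by (simp add: space_\<mu>)
    then show "(u x)\<^sup>2 \<le> (2 * s)\<^sup>2" by (simp only: abs_le_square_iff)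
  qed
  also have "\<dots> = ennreal (e / (C + 1) * C)"
    using C e unfolding s2 by (subst nn_integral_const) (simp add: space_\<mu> ennreal_mult[symmetric])
  also have "\<dots> \<le> ennreal e"
    using C e by (intro ennreal_leI) (simp add: field_simps)
  finally have u2: "(\<integral>\<^sup>+x. ennreal ((u x)\<^sup>2) \<partial>\<mu>) \<le> ennreal e" .
  have "(\<integral>\<^sup>+x. ennreal ((indicator (M \<union> A) x - p x)\<^sup>2) \<partial>\<mu>R)
     \<le> 2 * (\<integral>\<^sup>+x. ennreal ((indicator (M \<union> A) x - g x)\<^sup>2) \<partial>\<mu>R) + 2 * (\<integral>\<^sup>+x. ennreal ((g x - p x)\<^sup>2) \<partial>\<mu>R)"
    by (rule nn_integral_square_triangle) (simp_all add: measurable_cong_sets[OF sets_\<mu>R refl])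
  also have "\<dots> < ennreal e"
  proof (rule ennreal_two_quarters_less[OF e])
    have "(\<integral>\<^sup>+x. ennreal ((indicator (M \<union> A) x - g x)\<^sup>2) \<partial>\<mu>R) = (\<integral>\<^sup>+x. ennreal ((R x)\<^sup>2) \<partial>\<mu>)"
      by (subst nn_integral_\<mu>R[symmetric]) (auto simp: g_def)
    also have "\<dots> \<le> ennreal (e / 8)" by (rule R(5))
    also have "\<dots> < ennreal (e / 4)" using e by (intro ennreal_lessI) auto
    finally show "(\<integral>\<^sup>+x. ennreal ((indicator (M \<union> A) x - g x)\<^sup>2) \<partial>\<mu>R) < ennreal (e / 4)" .
    show "(\<integral>\<^sup>+x. ennreal ((g x - p x)\<^sup>2) \<partial>\<mu>R) < ennreal (e / 4)"
      using p(2) e'(2) by (meson ennreal_leI order_less_le_trans)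
  qed
  finally have "(\<integral>\<^sup>+x. ennreal ((p x - indicator (M \<union> A) x)\<^sup>2) \<partial>\<mu>) \<le> ennreal e"
    by (subst (asm) nn_integral_\<mu>R) (auto simp: power2_commute[of "p _"])
  with u2 u p show ?thesis by blast
qed

lemma L2_polynomial:
  assumes "real_polynomial_function p"
  shows "p \<in> L2 \<mu>"
proof -
  have "continuous_on {a..b} p"
    using assms by (simp add: continuous_on_polymonial_function real_polynomial_function_eq)
  then have "bounded (p ` {a..b})" by (intro compact_imp_bounded compact_continuous_image compact_Icc)
  then have "\<exists>B. \<forall>x\<in>{a..b}. \<bar>p x\<bar> \<le> B" by (auto simp: bounded_iff)
  then obtain B where B: "\<forall>x\<in>{a..b}. \<bar>p x\<bar> \<le> B" by blast
  have [measurable]: "p \<in> borel_measurable \<mu>"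
    by (intro measurable_\<mu> real_polynomial_function_measurable assms)
  have "integrable \<mu> (\<lambda>x. (p x)\<^sup>2)"
  proof (rule finite_measure.integrable_const_bound[OF fin])
    show "AE x in \<mu>. norm ((p x)\<^sup>2) \<le> B\<^sup>2"
    proof (intro AE_I2)
      fix x assume "x \<in> space \<mu>"
      then have "\<bar>p x\<bar> \<le> B" using B by (auto simp: space_\<mu> I_eq)
      then have "\<bar>p x\<bar>\<^sup>2 \<le> B\<^sup>2" by (rule power_mono) simp
      then show "norm ((p x)\<^sup>2) \<le> B\<^sup>2" by simp
    qed
  qed simp
  then show ?thesis by (simp add: L2_def)
qed

lemma L2_indicator:
  assumes "S \<in> sets borel"
  shows "indicator S \<in> L2 \<mu>"
proof -
  have [measurable]: "(indicator S :: real \<Rightarrow> real) \<in> borel_measurable \<mu>"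
    using assms by (intro measurable_\<mu>) simp
  have "integrable \<mu> (\<lambda>x. (indicator S x :: real)\<^sup>2)"
    by (rule finite_measure.integrable_const_bound[OF fin, of _ 1]) (auto split: split_indicator)
  then show ?thesis by (simp add: L2_def)
qed

lemma L2_tendsto_squeeze:
  assumes "\<And>n. u n \<in> L2 \<mu>" "w \<in> L2 \<mu>"
    and "\<And>n. (\<integral>\<^sup>+x. ennreal ((u n x - w x)\<^sup>2) \<partial>\<mu>) \<le> ennreal (e n)"
    and "e \<longlonglongrightarrow> 0" "\<And>n. 0 \<le> e n"
  shows "L2_tendsto \<mu> u w"
proof -
  have le: "(L2_norm \<mu> (\<lambda>x. u n x - w x))\<^sup>2 \<le> e n" for n
    using assms(3)[of n] nn_integral_square_L2[OF L2_diff[OF assms(1)[of n] assms(2)]] assms(5)[of n]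
    by (simp add: ennreal_le_iff)
  have n0: "0 \<le> L2_norm \<mu> h" for h unfolding L2_norm_def L2_inner_def by (simp add: integral_nonneg_AE)
  have "(\<lambda>n. L2_norm \<mu> (\<lambda>x. u n x - w x)) \<longlonglongrightarrow> 0"
  proof (rule tendsto_sandwich[of "\<lambda>_. 0" _ _ "\<lambda>n. sqrt (e n)"])
    show "(\<lambda>n. sqrt (e n)) \<longlonglongrightarrow> 0" using tendsto_real_sqrt[OF assms(4)] by simp
    show "\<forall>\<^sub>F n in sequentially. L2_norm \<mu> (\<lambda>x. u n x - w x) \<le> sqrt (e n)"
      by (intro always_eventually allI real_le_rsqrt le)
    show "\<forall>\<^sub>F n in sequentially. 0 \<le> L2_norm \<mu> (\<lambda>x. u n x - w x)"
      using n0 by simp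
  qed simp
  then show ?thesis using assms by (simp add: L2_tendsto_def)
qed

lemma indicator_in_gradients_zero: "indicator (M \<union> A) \<in> gradients I \<mu> (\<lambda>_. 0)"
proof -
  have "\<forall>n. \<exists>u p. real_polynomial_function u \<and> real_polynomial_function p
      \<and> (\<forall>x. (u has_real_derivative p x) (at x))
     \<and> (\<integral>\<^sup>+x. ennreal ((u x)\<^sup>2) \<partial>\<mu>) \<le> ennreal (inverse (real (Suc n)))
     \<and> (\<integral>\<^sup>+x. ennreal ((p x - indicator (M \<union> A) x)\<^sup>2) \<partial>\<mu>) \<le> ennreal (inverse (real (Suc n)))"
    by (intro allI indicator_approx_by_derivatives) simp
  from choice[OF this] obtain u where "\<forall>n. \<exists>p
      . real_polynomial_function (u n) \<and> real_polynomial_function p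
          \<and> (\<forall>x. (u n has_real_derivative p x) (at x))
     \<and> (\<integral>\<^sup>+x. ennreal ((u n x)\<^sup>2) \<partial>\<mu>) \<le> ennreal (inverse (real (Suc n)))
     \<and> (\<integral>\<^sup>+x. ennreal ((p x - indicator (M \<union> A) x)\<^sup>2) \<partial>\<mu>) \<le> ennreal (inverse (real (Suc n)))"
    by blast
  from choice[OF this] obtain p where up: "\<And>n. real_polynomial_function (u n)" "\<And>n
      . real_polynomial_function (p n)"
      "\<And>n x. (u n has_real_derivative p n x) (at x)"
      "\<And>n. (\<integral>\<^sup>+x. ennreal ((u n x)\<^sup>2) \<partial>\<mu>) \<le> ennreal (inverse (real (Suc n)))"
      "\<And>n. (\<integral>\<^sup>+x. ennreal ((p n x - indicator (M \<union> A) x)\<^sup>2) \<partial>\<mu>) \<le> ennreal (inverse (real (Suc n)))"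
    by blast
  have "deriv (u n) = p n" for n using up(3) by (intro ext DERIV_imp_deriv)
  moreover have "L2_tendsto \<mu> u (\<lambda>_. 0)"
    using up L2_indicator[of "{}"]
    by (intro L2_tendsto_squeeze[OF _ _ _ LIMSEQ_inverse_real_of_nat] L2_polynomial) (auto
        simp: indicator_def)
  moreover have "L2_tendsto \<mu> p (indicator (M \<union> A))"
    using up by (intro L2_tendsto_squeeze[OF _ _ _ LIMSEQ_inverse_real_of_nat] L2_polynomial L2_indicator)
        auto
  ultimately show ?thesis
    using up(1) by (auto simp: gradients_def intro!: exI[of _ u] smooth_closure_real_polynomial_function)
qed

section \<open>The projection of the constant function and the tangent space\<close>

text \<open>
  The function \<open>\<xi>\<close> is an arbitrary choice among the projections; having exhibited one of them, uniqueness
  almost everywhere identifies all of them.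
\<close>

lemma xi_AE: "AE x in \<mu>. xi I \<mu> x = indicator (M \<union> A) x"
proof -
  have one: "(\<lambda>_. 1) \<in> L2 \<mu>"
    using L2_indicator[of UNIV] by (simp add: indicator_def)
  have proj: "is_L2_projection \<mu> (gradients I \<mu> (\<lambda>_. 0)) (\<lambda>_. 1) (indicator (M \<union> A))"
    unfolding is_L2_projection_def
  proof (intro conjI ballI)
    show "indicator (M \<union> A) \<in> gradients I \<mu> (\<lambda>_. 0)" by (rule indicator_in_gradients_zero)
    fix w assume "w \<in> gradients I \<mu> (\<lambda>_. 0)"
    from gradient_zero_AE[OF this]
    have "AE x in \<mu>. (1 - indicator (M \<union> A) x) * w x = 0"
      by eventually_elim (auto split: split_indicator)
    then show "L2_inner \<mu> (\<lambda>x. 1 - indicator (M \<union> A) x) w = 0"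
      unfolding L2_inner_def by (rule integral_eq_zero_AE)
  qed
  then have "is_L2_projection \<mu> (gradients I \<mu> (\<lambda>_. 0)) (\<lambda>_. 1) (xi I \<mu>)"
    unfolding xi_def by (rule someI[of "is_L2_projection \<mu> (gradients I \<mu> (\<lambda>_. 0)) (\<lambda>_. 1)"])
  then show ?thesis
    by (rule is_L2_projection_AE_unique[OF gradients_subset_L2 one _ proj])
qed

end

lemma orthogonal_comp_span_singleton_real:
  fixes t :: real
  shows "orthogonal_comp (span {t}) = (if t = 0 then UNIV else {0})"
proof -
  have "orthogonal_comp (span {t}) = {y. t * y = 0}"
    by (auto simp: orthogonal_comp_def orthogonal_def span_singleton)
  then show ?thesis by auto
qed

theorem theorem2p1:
  fixes a b :: real and I A :: "real set" and \<mu> \<mu>a \<mu>s :: "real measure" and f :: "real \<Rightarrow> ennreal"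
  assumes "a < b" and "I = {a<..<b}"
    and "finite_measure \<mu>" and "sets \<mu> = sets (restrict_space borel I)"
    and "sets \<mu>a = sets \<mu>" and "sets \<mu>s = sets \<mu>"
    and "\<forall>E\<in>sets \<mu>. emeasure \<mu> E = emeasure \<mu>a E + emeasure \<mu>s E"
    and "absolutely_continuous (restrict_space lborel I) \<mu>a"
    and "A \<in> sets borel" and "A \<subseteq> I" and "emeasure lborel A = 0" and "emeasure \<mu>s (I - A) = 0"
    and "f \<in> borel_measurable (restrict_space lborel I)"
    and "\<mu>a = density (restrict_space lborel I) f"
  shows "AE x in \<mu>. tangent_space I \<mu> x = (if x \<in> degenerate_set I f \<union> A then {0} else UNIV)"
proof -
  have off: "emeasure \<mu> E = (\<integral>\<^sup>+x\<in>E. f x \<partial>lborel)" if E: "E \<in> sets borel" "E \<subseteq> I - A" for E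
  proof -
    have sI: "I \<in> sets borel" using assms(2) by simp
    have in_sets: "S \<in> sets \<mu>" if "S \<in> sets borel" "S \<subseteq> I" for S
      unfolding assms(4) sets_restrict_space using that by (intro image_eqI[of _ _ S]) auto
    have "emeasure \<mu>s E \<le> emeasure \<mu>s (I - A)"
      using E sI assms(9) by (intro emeasure_mono) (auto simp: assms(6) intro!: in_sets)
    then have "emeasure \<mu>s E = 0" using assms(12) by simp
    moreover have "emeasure \<mu>a E = (\<integral>\<^sup>+x. f x * indicator E x \<partial>restrict_space lborel I)"
      unfolding assms(14) using E sI assms(13)
      by (intro emeasure_density) (auto simp: sets_restrict_space intro!: image_eqI[of _ _ E])
    moreover have "\<dots> = (\<integral>\<^sup>+x\<in>E. f x \<partial>lborel)"
      using sI E by (subst nn_integral_restrict_space) (auto intro!: nn_integral_cong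
          split: split_indicator)
    moreover have "E \<in> sets \<mu>" using E by (intro in_sets) auto
    ultimately show ?thesis using assms(7) by simp
  qed
  interpret weighted_interval a b I A \<mu> f
    by (rule weighted_interval.intro) (fact assms off)+
  from xi_AE show ?thesis
    by eventually_elim (auto simp: tangent_space_def orthogonal_comp_span_singleton_real
        split: split_indicator)
qed

end
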